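(* Let $\mathbb{V}$ be a $7$-dimensional real vector space with a lorentzian inner product $\langle -,-\rangle$, and let $F\in\Lambda^3\mathbb{V}^*$. Then $[\iota_X F, F]=0$ for all $X\in\mathbb{V}$ if and only if $F=F_1+F_2$ for some simple $3$-forms $F_1,F_2\in\Lambda^3\mathbb{V}^*$ which are orthogonal to each other.
   Context: Lorentzian means a nondegenerate symmetric bilinear form of signature $(1,\dim\mathbb{V}-1)$ (one timelike direction). $\iota_X F$ is the $2$-form $F(X,-,-)$. A $2$-form $\omega\in\Lambda^2\mathbb{V}^*\cong\mathfrak{so}(\mathbb{V})$ acts on forms $\Omega\in\Lambda\mathbb{V}^*$ by $[\omega,\Omega]$, defined for $\omega=\alpha\wedge\beta$ with $\alpha,\beta\in\mathbb{V}^*$ by $$[\alpha\wedge\beta,\Omega]=\alpha\wedge\iota_{\beta^\sharp}\Omega-\beta\wedge\iota_{\alpha^\sharp}\Omega$$ and extended linearly in $\omega$, where $\alpha^\sharp\in\mathbb{V}$ is the vector dual to $\alpha$ under the inner product. A $p$-form is simple if it can be written as a wedge product of $p$ one-forms. A nonzero simple form determines a $p$-plane, the span of those one-forms, regarded as a subspace $\Pi\subset\mathbb{V}$ using the inner product to identify $\mathbb{V}^*$ with $\mathbb{V}$. Two nonzero simple $p$-forms are orthogonal if their planes satisfy $\langle X_1,X_2\rangle=0$ for all $X_1\in\Pi_1$, $X_2\in\Pi_2$; the planes may share a null direction. The zero form counts as simple and as orthogonal to every simple form (so $F$ simple is allowed as a degenerate case). *)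

theory Defs
  imports "HOL-Analysis.Analysis" "HOL-Library.Function_Algebras"
begin

definition symmetric_bilinear :: "('v::real_vector \<Rightarrow> 'v \<Rightarrow> real) \<Rightarrow> bool" where
  "symmetric_bilinear g \<longleftrightarrow> bilinear g \<and> (\<forall>x y. g x y = g y x)"

definition nondegenerate :: "('v::real_vector \<Rightarrow> 'v \<Rightarrow> real) \<Rightarrow> bool" where
  "nondegenerate g \<longleftrightarrow> (\<forall>x. (\<forall>y. g x y = 0) \<longrightarrow> x = 0)"

(* p positive and q negative directions in an orthogonal basis P \<union> N of the whole space. *)
definition has_signature :: "('v::real_vector \<Rightarrow> 'v \<Rightarrow> real) \<Rightarrow> nat \<Rightarrow> nat \<Rightarrow> bool" where
  "has_signature g p q \<longleftrightarrow>
    (\<exists>P N. finite P \<and> finite N \<and> P \<inter> N = {} \<and> card P = p \<and> card N = q \<and>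
      independent (P \<union> N) \<and> span (P \<union> N) = UNIV \<and>
      pairwise (\<lambda>x y. g x y = 0) (P \<union> N) \<and>
      (\<forall>x\<in>P. g x x > 0) \<and> (\<forall>x\<in>N. g x x < 0))"

(* The single timelike direction may be the positive one (signs + - ... -) or the
   negative one (signs - + ... +): both sign conventions are in use, and both are covered. *)
definition lorentzian :: "('v::real_vector \<Rightarrow> 'v \<Rightarrow> real) \<Rightarrow> bool" where
  "lorentzian g \<longleftrightarrow> symmetric_bilinear g \<and> nondegenerate g \<and>
    (has_signature g 1 (dim (UNIV :: 'v set) - 1) \<or>
     has_signature g (dim (UNIV :: 'v set) - 1) 1)"

(* Forms are curried alternating multilinear maps; a one-form is just a linear map to the reals.
   Addition and 0 are pointwise, from Function_Algebras. *)
type_synonym 'v form1 = "'v \<Rightarrow> real"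
type_synonym 'v form2 = "'v \<Rightarrow> 'v \<Rightarrow> real"
type_synonym 'v form3 = "'v \<Rightarrow> 'v \<Rightarrow> 'v \<Rightarrow> real"

definition is_form2 :: "'v::real_vector form2 \<Rightarrow> bool" where
  "is_form2 \<omega> \<longleftrightarrow> bilinear \<omega> \<and> (\<forall>X. \<omega> X X = 0)"

definition is_form3 :: "'v::real_vector form3 \<Rightarrow> bool" where
  "is_form3 F \<longleftrightarrow>
    (\<forall>Y Z. linear (\<lambda>X. F X Y Z)) \<and> (\<forall>X Z. linear (\<lambda>Y. F X Y Z)) \<and> (\<forall>X Y. linear (\<lambda>Z. F X Y Z)) \<and>
    (\<forall>X Y. F X X Y = 0) \<and> (\<forall>X Y. F X Y X = 0) \<and> (\<forall>X Y. F X Y Y = 0)"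

(* Contraction of a 3-form with a vector; F X Y Z being curried, it is partial application. *)
definition contract :: "'v \<Rightarrow> 'v form3 \<Rightarrow> 'v form2" where
  "contract X F = F X"

definition wedge11 :: "'v form1 \<Rightarrow> 'v form1 \<Rightarrow> 'v form2" where
  "wedge11 \<alpha> \<beta> = (\<lambda>X Y. \<alpha> X * \<beta> Y - \<alpha> Y * \<beta> X)"

definition wedge12 :: "'v form1 \<Rightarrow> 'v form2 \<Rightarrow> 'v form3" where
  "wedge12 \<alpha> \<omega> = (\<lambda>X Y Z. \<alpha> X * \<omega> Y Z - \<alpha> Y * \<omega> X Z + \<alpha> Z * \<omega> X Y)"

definition sharp :: "('v \<Rightarrow> 'v \<Rightarrow> real) \<Rightarrow> 'v form1 \<Rightarrow> 'v" where
  "sharp g \<alpha> = (THE v. \<forall>X. g v X = \<alpha> X)"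

definition bracket11 :: "('v \<Rightarrow> 'v \<Rightarrow> real) \<Rightarrow> 'v form1 \<Rightarrow> 'v form1 \<Rightarrow> 'v form3 \<Rightarrow> 'v form3" where
  "bracket11 g \<alpha> \<beta> \<Omega> =
    wedge12 \<alpha> (contract (sharp g \<beta>) \<Omega>) - wedge12 \<beta> (contract (sharp g \<alpha>) \<Omega>)"

(* The extension of bracket11, linear in the 2-form, to sums of decomposable 2-forms;
   well defined by bracket_wedge_sum and two_form_decomposition below. *)
definition bracket ::
  "('v::real_vector \<Rightarrow> 'v \<Rightarrow> real) \<Rightarrow> 'v form2 \<Rightarrow> 'v form3 \<Rightarrow> 'v form3" where
  "bracket g \<omega> \<Omega> = (THE \<Psi>. \<exists>(n::nat) \<alpha> \<beta>.
     (\<forall>i<n. linear (\<alpha> i) \<and> linear (\<beta> i)) \<and>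
     \<omega> = (\<Sum>i<n. wedge11 (\<alpha> i) (\<beta> i)) \<and>
     \<Psi> = (\<Sum>i<n. bracket11 g (\<alpha> i) (\<beta> i) \<Omega>))"

definition simple_form3 :: "'v::real_vector form3 \<Rightarrow> bool" where
  "simple_form3 F \<longleftrightarrow>
    (\<exists>\<alpha> \<beta> \<gamma>. linear \<alpha> \<and> linear \<beta> \<and> linear \<gamma> \<and> F = wedge12 \<alpha> (wedge11 \<beta> \<gamma>))"

(* The plane of a nonzero simple 3-form; it is unique by plane_of_unique below. *)
definition plane_of :: "('v::real_vector \<Rightarrow> 'v \<Rightarrow> real) \<Rightarrow> 'v form3 \<Rightarrow> 'v set \<Rightarrow> bool" where
  "plane_of g F S \<longleftrightarrow> F \<noteq> 0 \<and>
    (\<exists>\<alpha> \<beta> \<gamma>. linear \<alpha> \<and> linear \<beta> \<and> linear \<gamma> \<and> F = wedge12 \<alpha> (wedge11 \<beta> \<gamma>) \<and>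
      S = span {sharp g \<alpha>, sharp g \<beta>, sharp g \<gamma>})"

definition orthogonal_forms3 :: "('v::real_vector \<Rightarrow> 'v \<Rightarrow> real) \<Rightarrow> 'v form3 \<Rightarrow> 'v form3 \<Rightarrow> bool" where
  "orthogonal_forms3 g F1 F2 \<longleftrightarrow> F1 = 0 \<or> F2 = 0 \<or>
    (\<exists>S1 S2. plane_of g F1 S1 \<and> plane_of g F2 S2 \<and> (\<forall>X1\<in>S1. \<forall>X2\<in>S2. g X1 X2 = 0))"

lemma has_signature_basis:
  assumes "has_signature g p q"
  obtains B where "finite B" "independent B" "span B = (UNIV::'v::real_vector set)"
    "pairwise (\<lambda>x y. g x y = 0) B" "\<forall>b\<in>B. g b b \<noteq> 0"
  using assms unfolding has_signature_def
  by (metis Un_iff finite_Un less_numeral_extra(3))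

lemma linear_ext_basis:
  fixes f h :: "'v::real_vector \<Rightarrow> real"
  assumes "span B = UNIV" "linear f" "linear h" "\<And>b. b \<in> B \<Longrightarrow> f b = h b"
  shows "f = h"
  using linear_eq_on_span[OF assms(2,3,4)] assms(1) by blast

lemma lorentzian_sharp:
  fixes g :: "'v::real_vector \<Rightarrow> 'v \<Rightarrow> real"
  assumes "lorentzian g" "linear \<alpha>"
  shows "g (sharp g \<alpha>) X = \<alpha> X"
proof -
  obtain B where B: "finite B" "independent B" "span B = (UNIV::'v set)"
    "pairwise (\<lambda>x y. g x y = 0) B" "\<forall>b\<in>B. g b b \<noteq> 0"
    using assms(1) has_signature_basis unfolding lorentzian_def by metis
  have bil: "bilinear g" and sym: "\<And>x y. g x y = g y x"
    using assms(1) by (auto simp: lorentzian_def symmetric_bilinear_def)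
  have nd: "nondegenerate g" using assms(1) by (auto simp: lorentzian_def)
  define v where "v = (\<Sum>b\<in>B. (\<alpha> b / g b b) *\<^sub>R b)"
  have lin1: "linear (\<lambda>x. g x y)" "linear (g x)" for x y
    using bil by (auto simp: bilinear_def)
  have "g v b = \<alpha> b" if "b \<in> B" for b
  proof -
    have "g v b = (\<Sum>c\<in>B. (\<alpha> c / g c c) * g c b)"
      unfolding v_def by (simp add: linear_sum[OF lin1(1)] linear_scale[OF lin1(1)])
    also have "\<dots> = (\<Sum>c\<in>B. if c = b then \<alpha> b else 0)"
      by (rule sum.cong) (use B that in \<open>auto simp: pairwise_def\<close>)
    finally show ?thesis using B that by simp
  qed
  then have v: "g v = \<alpha>" by (intro linear_ext_basis[OF B(3) lin1(2) assms(2)])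
  have "w = v" if "\<forall>X. g w X = \<alpha> X" for w
  proof -
    have "\<forall>X. g (w - v) X = 0" using linear_diff[OF lin1(1)] v that by simp
    then show ?thesis using nd by (auto simp: nondegenerate_def)
  qed
  then have "sharp g \<alpha> = v" unfolding sharp_def using v by (intro the_equality) auto
  then show ?thesis using v by simp
qed

lemma lorentzian_cancel:
  fixes g :: "'v::real_vector \<Rightarrow> 'v \<Rightarrow> real"
  assumes "lorentzian g" "\<And>X. g v X = g w X"
  shows "v = w"
proof -
  have lin: "linear (\<lambda>x. g x y)" for y
    using assms(1) by (auto simp: bilinear_def lorentzian_def symmetric_bilinear_def)
  have "\<forall>X. g (v - w) X = 0" using linear_diff[OF lin] assms(2) by simp
  then show ?thesis using assms(1) by (auto simp: nondegenerate_def lorentzian_def)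
qed

(* The bracket through the skew endomorphism X \<mapsto> sharp g (\<omega> X) corresponding to \<omega>. *)
definition skew_action :: "('v \<Rightarrow> 'v \<Rightarrow> real) \<Rightarrow> 'v form2 \<Rightarrow> 'v form3 \<Rightarrow> 'v form3" where
  "skew_action g \<omega> \<Omega> = (\<lambda>X Y Z.
     \<Omega> (sharp g (\<omega> X)) Y Z + \<Omega> X (sharp g (\<omega> Y)) Z + \<Omega> X Y (sharp g (\<omega> Z)))"

lemma sum_fun_apply: "(\<Sum>i\<in>A. f i) x = (\<Sum>i\<in>A. f i x)"
  by (induction A rule: infinite_finite_induct) auto

lemma form3_swap:
  assumes "is_form3 F"
  shows "F Y X Z = - F X Y Z" "F X Z Y = - F X Y Z"
proof -
  have l: "F (X + X') Y Z = F X Y Z + F X' Y Z" "F X (Y + Y') Z = F X Y Z + F X Y' Z"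
     "F X Y (Z + Z') = F X Y Z + F X Y Z'" for X X' Y Y' Z Z'
    using assms linear_add unfolding is_form3_def by blast+
  have z: "F X X Y = 0" "F X Y Y = 0" for X Y using assms unfolding is_form3_def by auto
  show "F Y X Z = - F X Y Z" using z(1)[of "X + Y" Z] z(1)[of X Z] z(1)[of Y Z] unfolding l by linarith
  show "F X Z Y = - F X Y Z" using z(2)[of X "Y + Z"] z(2)[of X Y] z(2)[of X Z] unfolding l by linarith
qed

lemma bracket11_skew_action:
  fixes g :: "'v::real_vector \<Rightarrow> 'v \<Rightarrow> real"
  assumes "lorentzian g" "is_form3 \<Omega>" "linear \<alpha>" "linear \<beta>"
  shows "bracket11 g \<alpha> \<beta> \<Omega> = skew_action g (wedge11 \<alpha> \<beta>) \<Omega>"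
proof -
  note S = lorentzian_sharp[OF assms(1)]
  have bil: "bilinear g" using assms(1) by (auto simp: lorentzian_def symmetric_bilinear_def)
  have gl: "linear (\<lambda>x. g x y)" for y using bil by (auto simp: bilinear_def)
  have lin: "linear (wedge11 \<alpha> \<beta> X)" for X
    unfolding wedge11_def using assms(3,4)
    by (auto intro!: linearI simp: linear_add linear_scale algebra_simps)
  have sh: "sharp g (wedge11 \<alpha> \<beta> X) = \<alpha> X *\<^sub>R sharp g \<beta> - \<beta> X *\<^sub>R sharp g \<alpha>" for X
    by (rule lorentzian_cancel[OF assms(1)])
       (simp add: S lin assms linear_diff[OF gl] linear_scale[OF gl], simp add: wedge11_def)
  have l: "\<Omega> (a *\<^sub>R X - b *\<^sub>R X') Y Z = a * \<Omega> X Y Z - b * \<Omega> X' Y Z"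
     "\<Omega> X (a *\<^sub>R Y - b *\<^sub>R Y') Z = a * \<Omega> X Y Z - b * \<Omega> X Y' Z"
     "\<Omega> X Y (a *\<^sub>R Z - b *\<^sub>R Z') = a * \<Omega> X Y Z - b * \<Omega> X Y Z'" for X X' Y Y' Z Z' a b
  proof -
    have "linear (\<lambda>X. \<Omega> X Y Z)" "linear (\<lambda>Y. \<Omega> X Y Z)" "linear (\<lambda>Z. \<Omega> X Y Z)" for X Y Z
      using assms(2) unfolding is_form3_def by auto
    note L = this
    show "\<Omega> (a *\<^sub>R X - b *\<^sub>R X') Y Z = a * \<Omega> X Y Z - b * \<Omega> X' Y Z"
      by (simp add: linear_diff[OF L(1)] linear_scale[OF L(1)])
    show "\<Omega> X (a *\<^sub>R Y - b *\<^sub>R Y') Z = a * \<Omega> X Y Z - b * \<Omega> X Y' Z"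
      by (simp add: linear_diff[OF L(2)] linear_scale[OF L(2)])
    show "\<Omega> X Y (a *\<^sub>R Z - b *\<^sub>R Z') = a * \<Omega> X Y Z - b * \<Omega> X Y Z'"
      by (simp add: linear_diff[OF L(3)] linear_scale[OF L(3)])
  qed
  have "bracket11 g \<alpha> \<beta> \<Omega> X Y Z = skew_action g (wedge11 \<alpha> \<beta>) \<Omega> X Y Z" for X Y Z
  proof -
    have m: "\<Omega> X (sharp g \<xi>) Z = - \<Omega> (sharp g \<xi>) X Z" "\<Omega> X Y (sharp g \<xi>) = \<Omega> (sharp g \<xi>) X Y" for \<xi>
      using form3_swap(1)[OF assms(2), of X "sharp g \<xi>" Z] form3_swap(2)[OF assms(2), of X Y "sharp g \<xi>"]
        form3_swap(1)[OF assms(2), of X "sharp g \<xi>" Y] by linarith+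
    show ?thesis
      unfolding bracket11_def skew_action_def wedge12_def contract_def sh l fun_diff_def m
      by (simp add: algebra_simps)
  qed
  then show ?thesis by (intro ext)
qed

lemma skew_action_sum:
  fixes g :: "'v::real_vector \<Rightarrow> 'v \<Rightarrow> real"
  assumes "lorentzian g" "is_form3 \<Omega>" "finite I" "\<And>i X. i \<in> I \<Longrightarrow> linear (\<omega> i X)"
  shows "skew_action g (\<Sum>i\<in>I. \<omega> i) \<Omega> = (\<Sum>i\<in>I. skew_action g (\<omega> i) \<Omega>)"
proof -
  have gl: "linear (\<lambda>x. g x y)" for y
    using assms(1) by (auto simp: bilinear_def lorentzian_def symmetric_bilinear_def)
  have lin: "linear (\<lambda>Y. \<Sum>i\<in>I. \<omega> i X Y)" for X
    using assms(4)
    by (auto intro!: linearI simp: linear_add linear_scale sum.distrib sum_distrib_left)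
  have "(\<Sum>i\<in>I. \<omega> i X) = (\<lambda>Y. \<Sum>i\<in>I. \<omega> i X Y)" for X
    by (intro ext) (simp add: sum_fun_apply)
  then have sh: "sharp g (\<Sum>i\<in>I. \<omega> i X) = (\<Sum>i\<in>I. sharp g (\<omega> i X))" for X
    by (intro lorentzian_cancel[OF assms(1)])
       (simp add: lorentzian_sharp[OF assms(1)] lin assms linear_sum[OF gl])
  have l: "\<Omega> (\<Sum>i\<in>I. V i) Y Z = (\<Sum>i\<in>I. \<Omega> (V i) Y Z)"
    "\<Omega> X (\<Sum>i\<in>I. V i) Z = (\<Sum>i\<in>I. \<Omega> X (V i) Z)"
    "\<Omega> X Y (\<Sum>i\<in>I. V i) = (\<Sum>i\<in>I. \<Omega> X Y (V i))" for V X Y Z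
    using assms(2) linear_sum unfolding is_form3_def by blast+
  show ?thesis
    by (intro ext) (simp add: skew_action_def sum_fun_apply sh l sum.distrib)
qed

lemma linear_wedge11: "linear \<alpha> \<Longrightarrow> linear \<beta> \<Longrightarrow> linear (wedge11 \<alpha> \<beta> X)"
  unfolding wedge11_def by (auto intro!: linearI simp: linear_add linear_scale algebra_simps)

lemma bracket_wedge_sum:
  fixes g :: "'v::real_vector \<Rightarrow> 'v \<Rightarrow> real"
  assumes "lorentzian g" "is_form3 \<Omega>" "\<And>i. i < n \<Longrightarrow> linear (\<alpha> i) \<and> linear (\<beta> i)"
  shows "bracket g (\<Sum>i<(n::nat). wedge11 (\<alpha> i) (\<beta> i)) \<Omega> = (\<Sum>i<n. bracket11 g (\<alpha> i) (\<beta> i) \<Omega>)"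
proof -
  have *: "(\<Sum>i<n. bracket11 g (\<alpha> i) (\<beta> i) \<Omega>) = skew_action g (\<Sum>i<n. wedge11 (\<alpha> i) (\<beta> i)) \<Omega>"
    if "\<forall>i<n. linear (\<alpha> i) \<and> linear (\<beta> i)" for n :: nat and \<alpha> \<beta>
    using that skew_action_sum[OF assms(1,2), of "{..<n}" "\<lambda>i. wedge11 (\<alpha> i) (\<beta> i)"]
    by (simp add: linear_wedge11 bracket11_skew_action[OF assms(1,2)])
  have \<alpha>\<beta>: "\<forall>i<n. linear (\<alpha> i) \<and> linear (\<beta> i)" using assms(3) by simp
  show ?thesis unfolding bracket_def
  proof (rule the_equality)
    show "\<exists>(m::nat) \<alpha>' \<beta>'. (\<forall>i<m. linear (\<alpha>' i) \<and> linear (\<beta>' i)) \<and>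
       (\<Sum>i<n. wedge11 (\<alpha> i) (\<beta> i)) = (\<Sum>i<m. wedge11 (\<alpha>' i) (\<beta>' i)) \<and>
       (\<Sum>i<n. bracket11 g (\<alpha> i) (\<beta> i) \<Omega>) = (\<Sum>i<m. bracket11 g (\<alpha>' i) (\<beta>' i) \<Omega>)"
      using \<alpha>\<beta> by (intro exI conjI) (assumption, rule refl, rule refl)
  next
    fix \<Psi> assume "\<exists>(m::nat) \<alpha>' \<beta>'. (\<forall>i<m. linear (\<alpha>' i) \<and> linear (\<beta>' i)) \<and>
       (\<Sum>i<n. wedge11 (\<alpha> i) (\<beta> i)) = (\<Sum>i<m. wedge11 (\<alpha>' i) (\<beta>' i)) \<and>
       \<Psi> = (\<Sum>i<m. bracket11 g (\<alpha>' i) (\<beta>' i) \<Omega>)"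
    then obtain m :: nat and \<alpha>' \<beta>' where
      m: "\<forall>i<m. linear (\<alpha>' i) \<and> linear (\<beta>' i)"
        "(\<Sum>i<n. wedge11 (\<alpha> i) (\<beta> i)) = (\<Sum>i<m. wedge11 (\<alpha>' i) (\<beta>' i))"
        "\<Psi> = (\<Sum>i<m. bracket11 g (\<alpha>' i) (\<beta>' i) \<Omega>)"
      by (elim exE conjE)
    show "\<Psi> = (\<Sum>i<n. bracket11 g (\<alpha> i) (\<beta> i) \<Omega>)"
      unfolding m(3) *[OF m(1)] *[OF \<alpha>\<beta>] m(2) ..
  qed
qed

lemma two_form_decomposition:
  fixes g :: "'v::real_vector \<Rightarrow> 'v \<Rightarrow> real" and \<omega> :: "'v form2"
  assumes "lorentzian g" "is_form2 \<omega>"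
  obtains n :: nat and \<alpha> \<beta> where "\<And>i. i < n \<Longrightarrow> linear (\<alpha> i) \<and> linear (\<beta> i)"
    "\<omega> = (\<Sum>i<n. wedge11 (\<alpha> i) (\<beta> i))"
proof -
  obtain B where B: "finite B" "independent B" "span B = (UNIV::'v set)"
    using assms(1) has_signature_basis unfolding lorentzian_def by metis
  obtain e where e: "bij_betw e {..<card B} B"
    using ex_bij_betw_nat_finite[OF B(1)] by (auto simp: atLeast0LessThan)
  define \<alpha> where "\<alpha> i = (\<lambda>X. (1/2) * representation B X (e i))" for i
  have l\<alpha>: "linear (\<alpha> i)" for i
    unfolding \<alpha>_def using B(2,3)
    by (auto intro!: linearI simp: real_vector.representation_add real_vector.representation_scale algebra_simps)
  have lw: "linear (\<lambda>X. \<omega> X Y)" "linear (\<omega> X)" for X Y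
    using assms(2) by (auto simp: is_form2_def bilinear_def)
  have asym: "\<omega> Y X = - \<omega> X Y" for X Y
  proof -
    have "\<omega> (X + Y) (X + Y) = 0" "\<omega> X X = 0" "\<omega> Y Y = 0" using assms(2) by (auto simp: is_form2_def)
    then show ?thesis by (simp add: linear_add[OF lw(1)] linear_add[OF lw(2)])
  qed
  have ex: "\<omega> X Y = (\<Sum>i<card B. 2 * \<alpha> i X * \<omega> (e i) Y)" for X Y
  proof -
    have "\<omega> X Y = \<omega> (\<Sum>b\<in>B. representation B X b *\<^sub>R b) Y"
      using real_vector.sum_representation_eq[OF B(2) _ B(1) order_refl] B(3) by simp
    also have "\<dots> = (\<Sum>b\<in>B. representation B X b * \<omega> b Y)"
      by (simp add: linear_sum[OF lw(1)] linear_scale[OF lw(1)])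
    also have "\<dots> = (\<Sum>i<card B. representation B X (e i) * \<omega> (e i) Y)"
      by (rule sum.reindex_bij_betw[OF e, symmetric])
    finally show ?thesis by (simp add: \<alpha>_def)
  qed
  have "\<omega> X Y = (\<Sum>i<card B. wedge11 (\<alpha> i) (\<omega> (e i))) X Y" for X Y
  proof -
    have "(\<Sum>i<card B. wedge11 (\<alpha> i) (\<omega> (e i))) X Y
        = (\<Sum>i<card B. \<alpha> i X * \<omega> (e i) Y) - (\<Sum>i<card B. \<alpha> i Y * \<omega> (e i) X)"
      by (simp add: sum_fun_apply wedge11_def sum_subtractf)
    also have "2 * \<dots> = \<omega> X Y - \<omega> Y X"
      using ex[of X Y] ex[of Y X] by (simp add: sum_distrib_left algebra_simps)
    finally show ?thesis using asym[of X Y] by simp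
  qed
  then have "\<omega> = (\<Sum>i<card B. wedge11 (\<alpha> i) (\<omega> (e i)))" by (intro ext)
  then show thesis using l\<alpha> lw(2) by (intro that[of "card B" \<alpha> "\<lambda>i. \<omega> (e i)"]) simp_all
qed

lemma plane_of_unique:
  fixes g :: "'v::real_vector \<Rightarrow> 'v \<Rightarrow> real"
  assumes "lorentzian g" "plane_of g F S" "plane_of g F S'"
  shows "S = S'"
proof -
  have bil: "bilinear g" using assms(1) by (auto simp: lorentzian_def symmetric_bilinear_def)
  have gl: "linear (\<lambda>x. g x y)" for y using bil by (auto simp: bilinear_def)
  have F0: "F \<noteq> 0" using assms(2) by (simp add: plane_of_def)
  have incl: "S \<subseteq> S'" if P: "plane_of g F S" and P': "plane_of g F S'" for S S'
  proof -
    obtain \<alpha> \<beta> \<gamma> where a: "linear \<alpha>" "linear \<beta>" "linear \<gamma>" "F = wedge12 \<alpha> (wedge11 \<beta> \<gamma>)"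
      "S = span {sharp g \<alpha>, sharp g \<beta>, sharp g \<gamma>}" using P by (auto simp: plane_of_def)
    obtain \<alpha>' \<beta>' \<gamma>' where a': "linear \<alpha>'" "linear \<beta>'" "linear \<gamma>'" "F = wedge12 \<alpha>' (wedge11 \<beta>' \<gamma>')"
      "S' = span {sharp g \<alpha>', sharp g \<beta>', sharp g \<gamma>'}" using P' by (auto simp: plane_of_def)
    obtain X Y Z where nz: "F X Y Z \<noteq> 0" using F0 by (metis ext zero_fun_apply)
    have inF: "sharp g (F U V) \<in> S'" "linear (F U V)" for U V
    proof -
      define p q r where "p = wedge11 \<beta>' \<gamma>' U V" and "q = - wedge11 \<alpha>' \<gamma>' U V" and "r = wedge11 \<alpha>' \<beta>' U V"
      have eq: "F U V = (\<lambda>W. p * \<alpha>' W + q * \<beta>' W + r * \<gamma>' W)"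
        unfolding a'(4) p_def q_def r_def wedge12_def wedge11_def by (intro ext) (simp add: algebra_simps)
      show lin: "linear (F U V)" unfolding eq
        by (auto intro!: linearI simp: linear_add[OF a'(1)] linear_add[OF a'(2)] linear_add[OF a'(3)]
            linear_scale[OF a'(1)] linear_scale[OF a'(2)] linear_scale[OF a'(3)] algebra_simps)
      have "sharp g (F U V) = p *\<^sub>R sharp g \<alpha>' + q *\<^sub>R sharp g \<beta>' + r *\<^sub>R sharp g \<gamma>'"
        by (rule lorentzian_cancel[OF assms(1)])
          (simp add: lorentzian_sharp[OF assms(1)] lin a'(1-3) linear_add[OF gl] linear_scale[OF gl],
           simp add: eq)
      then show "sharp g (F U V) \<in> S'" unfolding a'(5)
        by (auto intro!: span_add span_scale intro: span_base)
    qed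
    have gen: "sharp g \<xi> \<in> S'" if "linear \<xi>"
      "\<And>W. F X Y Z * \<xi> W = \<xi> X * F Y Z W + \<xi> Y * F Z X W + \<xi> Z * F X Y W" for \<xi>
    proof -
      have "sharp g \<xi> = (\<xi> X / F X Y Z) *\<^sub>R sharp g (F Y Z) + (\<xi> Y / F X Y Z) *\<^sub>R sharp g (F Z X)
          + (\<xi> Z / F X Y Z) *\<^sub>R sharp g (F X Y)"
        by (rule lorentzian_cancel[OF assms(1)])
          (use that(2) nz in \<open>simp add: lorentzian_sharp[OF assms(1)] that(1) inF(2) linear_add[OF gl]
             linear_scale[OF gl] field_simps\<close>)
      moreover have "subspace S'" unfolding a'(5) by simp
      ultimately show ?thesis using inF(1) by (simp add: subspace_add subspace_scale)
    qed
    have "{sharp g \<alpha>, sharp g \<beta>, sharp g \<gamma>} \<subseteq> S'"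
    proof -
      have "sharp g \<alpha> \<in> S'" "sharp g \<beta> \<in> S'" "sharp g \<gamma> \<in> S'"
        by (rule gen, use a in blast, unfold a(4) wedge12_def wedge11_def, simp add: algebra_simps)+
      then show ?thesis by simp
    qed
    then show ?thesis unfolding a(5) using span_minimal a'(5) by (metis subspace_span)
  qed
  show ?thesis using incl assms(2,3) by blast
qed

end

theory Submission
  imports Defs
begin

text \<open>Put \<open>[X, Y] = (F X Y)\<^sup>\<sharp>\<close>. The condition on \<open>F\<close> is the Jacobi identity for this bracket, so \<open>F\<close>
  is the structure form of a Lie algebra with an invariant Lorentzian inner product, and the claim
  is a normal form for such algebras in dimension 7.

  If \<open>F \<noteq> 0\<close>, some timelike \<open>t\<close> is not central, because timelike vectors span. The derivation \<open>ad t\<close> is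
  skew on the definite space orthogonal to \<open>t\<close>, so it rotates mutually orthogonal planes with nonzero
  frequencies and vanishes on their orthogonal complement \<open>h\<close>, which contains \<open>t\<close>.
  Three planes (\<open>h\<close> spanned by \<open>t\<close>) contradict the Jacobi identity.
  With one plane, \<open>e1\<close>, \<open>e2\<close>, the restriction of \<open>F\<close> to \<open>h\<close> is a 3-form in effectively four dimensions,
  hence simple, and \<open>F\<close> is its sum with \<open>[e1, e2] \<and> e1 \<and> e2\<close>.
  With two planes, \<open>h\<close> is abelian of dimension 3, and once the planes are invariant under all of \<open>h\<close>,
  \<open>F = [e1, e2] \<and> e1 \<and> e2 + [e3, e4] \<and> e3 \<and> e4\<close>. The planes need adjusting only if the two frequencies
  agree and some \<open>f\<close> in \<open>h\<close> does not act as a multiple of \<open>t\<close>; they are then taken invariant under \<open>f\<close> as well.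
  In each case the Jacobi identity makes the two summands orthogonal.\<close>

text \<open>The simple form of three vectors: lowering them with \<open>g\<close> yields its
  one-form factors, so orthogonality can be stated for vectors.\<close>

abbreviation vol :: "('v \<Rightarrow> 'v \<Rightarrow> real) \<Rightarrow> 'v \<Rightarrow> 'v \<Rightarrow> 'v \<Rightarrow> 'v form3" where
  "vol g a b c \<equiv> wedge12 (g a) (wedge11 (g b) (g c))"

section \<open>Preliminaries\<close>

text \<open>The eigenvector maximises the Rayleigh quotient; compactness is available after transport to
  \<^typ>\<open>real ^ 'n\<close>.\<close>

lemma ex_symmetric_eigenvector:
  fixes g :: "'v::real_vector \<Rightarrow> 'v \<Rightarrow> real"
  assumes bil: "bilinear g" and sym: "\<And>x y. g x y = g y x"
    and b: "inj (b :: 'n::finite \<Rightarrow> 'v)" "independent (range b)" "span (range b) = UNIV"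
    and U: "subspace U" "U \<noteq> {0}" and pos: "\<And>x. x \<in> U \<Longrightarrow> x \<noteq> 0 \<Longrightarrow> g x x > 0"
    and S: "linear S" "\<And>x. x \<in> U \<Longrightarrow> S x \<in> U"
      "\<And>x y. x \<in> U \<Longrightarrow> y \<in> U \<Longrightarrow> g (S x) y = g x (S y)"
  obtains v m where "v \<in> U" "g v v = 1" "S v = m *\<^sub>R v"
proof -
  define \<phi> where "\<phi> x = (\<Sum>i\<in>UNIV. x $ i *\<^sub>R b i)" for x :: "real ^ 'n"
  have lin\<phi>: "linear \<phi>" unfolding \<phi>_def
    by (intro linearI) (simp_all add: scaleR_add_left sum.distrib scaleR_sum_right)
  have surj: "\<exists>x. y = \<phi> x" for y
  proof -
    have "y \<in> span (range b)" using b by simp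
    then obtain u where "y = (\<Sum>v\<in>range b. u v *\<^sub>R v)"
      using span_finite[of "range b"] by auto
    then have "y = \<phi> (\<chi> i. u (b i))" unfolding \<phi>_def using b(1) by (simp add: sum.reindex)
    then show ?thesis ..
  qed
  have inj: "x = 0" if "\<phi> x = 0" for x
  proof -
    have "(\<Sum>v\<in>range b. (x $ (inv b v)) *\<^sub>R v) = 0"
      using that b(1) by (simp add: \<phi>_def sum.reindex)
    then have "x $ (inv b v) = 0" if "v \<in> range b" for v
      using independentD[OF b(2), of "range b" "\<lambda>v. x $ (inv b v)" v] that by auto
    then have "x $ i = 0" for i using b(1) by (metis inv_f_f rangeI)
    then show ?thesis by (simp add: vec_eq_iff)
  qed
  note gl = bilinear_ladd[OF bil] bilinear_radd[OF bil] bilinear_lmul[OF bil] bilinear_rmul[OF bil]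
    bilinear_lsub[OF bil] bilinear_rsub[OF bil] bilinear_lzero[OF bil] bilinear_rzero[OF bil]
  have lg: "linear (g y)" "linear (\<lambda>x. g x y)" for y using bil by (auto simp: bilinear_def)
  define K where "K = {x. \<phi> x \<in> U} \<inter> sphere 0 1"
  have subK: "subspace {x. \<phi> x \<in> U}"
    using lin\<phi> U(1) by (auto simp: subspace_def linear_add linear_scale linear_0)
  have "compact K"
    unfolding K_def by (intro closed_Int_compact closed_subspace subK compact_sphere)
  moreover obtain u0 where u0: "u0 \<in> U" "u0 \<noteq> 0" using U subspace_0 by fastforce
  have norm_in: "(1 / norm x) *\<^sub>R x \<in> K" if "\<phi> x \<in> U" "x \<noteq> 0" for x
    using that subspace_scale[OF subK, of x "1 / norm x"] by (simp add: K_def)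
  have "K \<noteq> {}"
  proof -
    obtain x where "u0 = \<phi> x" using surj by blast
    moreover then have "x \<noteq> 0" using u0(2) linear_0[OF lin\<phi>] by auto
    ultimately show ?thesis using norm_in u0 by blast
  qed
  moreover
  define R where "R x = g (S (\<phi> x)) (\<phi> x) / g (\<phi> x) (\<phi> x)" for x
  have K0: "g (\<phi> x) (\<phi> x) > 0" if "x \<in> K" for x
  proof -
    have "x \<noteq> 0" using that by (auto simp: K_def)
    then have "\<phi> x \<noteq> 0" using inj by blast
    then show ?thesis using that pos by (simp add: K_def)
  qed
  have "continuous_on K R"
  proof -
    have l: "g (\<phi> x) y = (\<Sum>i\<in>UNIV. x $ i * g (b i) y)"
      "g y (\<phi> x) = (\<Sum>i\<in>UNIV. x $ i * g y (b i))" for x y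
      unfolding \<phi>_def
      by (simp_all add: linear_sum[OF lg(1)] linear_sum[OF lg(2)] gl)
    have "S (\<phi> x) = (\<Sum>i\<in>UNIV. x $ i *\<^sub>R S (b i))" for x
      unfolding \<phi>_def by (simp add: linear_sum[OF S(1)] linear_scale[OF S(1)])
    then have lS: "g (S (\<phi> x)) y = (\<Sum>i\<in>UNIV. x $ i * g (S (b i)) y)" for x y
      by (simp add: linear_sum[OF lg(2)] gl)
    have "continuous_on K (\<lambda>x. g (\<phi> x) (\<phi> x))" "continuous_on K (\<lambda>x. g (S (\<phi> x)) (\<phi> x))"
      unfolding lS l by (intro continuous_intros)+
    then show ?thesis unfolding R_def using K0 by (intro continuous_intros) force+
  qed
  ultimately obtain x0 where x0: "x0 \<in> K" "\<And>x. x \<in> K \<Longrightarrow> R x \<le> R x0"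
    using continuous_attains_sup by metis
  define m where "m = R x0"
  define w where "w = \<phi> x0"
  have wU: "w \<in> U" and w0: "g w w > 0" using x0(1) K0 by (auto simp: w_def K_def)
  \<comment> \<open>\<open>q\<close> is positive semidefinite on \<open>U\<close> because
    \<open>m\<close> is the maximal quotient, and \<open>w\<close> is a null vector of it; a null
    vector of a semidefinite form lies in its radical.\<close>
  define q where "q x y = m * g x y - g (S x) y" for x y
  have qpos: "q x x \<ge> 0" if "x \<in> U" for x
  proof (cases "x = 0")
    case True then show ?thesis by (simp add: q_def gl)
  next
    case False
    obtain z where z: "x = \<phi> z" using surj by blast
    have z0: "z \<noteq> 0" using z False linear_0[OF lin\<phi>] by auto
    have "R ((1 / norm z) *\<^sub>R z) = g (S x) x / g x x" using z0
      by (simp add: R_def linear_scale[OF lin\<phi>] linear_scale[OF S(1)] gl z)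
    then have "g (S x) x / g x x \<le> m" using x0(2)[OF norm_in[of z]] that z z0 by (simp add: m_def)
    then show ?thesis using pos[OF that False] by (simp add: q_def field_simps)
  qed
  have qw: "q w w = 0" using w0 by (simp add: q_def m_def R_def w_def)
  have q0: "q w y = 0" if "y \<in> U" for y
  proof -
    have e: "q (w + t *\<^sub>R y) (w + t *\<^sub>R y) = 2 * t * q w y + t\<^sup>2 * q y y" for t
      using qw S(3)[OF that wU] sym[of w y] sym[of "S w" y]
      unfolding q_def gl linear_add[OF S(1)] linear_scale[OF S(1)]
      by (simp add: gl algebra_simps power2_eq_square)
    have p: "2 * t * q w y + t\<^sup>2 * q y y \<ge> 0" for t
      unfolding e[symmetric] using that wU U(1) by (intro qpos) (simp add: subspace_add subspace_scale)
    show ?thesis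
    proof (rule ccontr)
      assume n: "q w y \<noteq> 0"
      \<comment> \<open>The summand 1 keeps \<open>d\<close> positive when \<open>q y y = 0\<close>;
        at \<open>t = - q w y / d\<close> the quadratic in \<open>p\<close> is negative.\<close>
      define d where "d = q y y + 1"
      have d: "d > 0" using qpos[OF that] by (simp add: d_def)
      have "2 * (- q w y / d) * q w y + (- q w y / d)\<^sup>2 * q y y = ((q w y)\<^sup>2 / d\<^sup>2) * (q y y - 2 * d)"
        using d by (simp add: field_simps power2_eq_square)
      also have "\<dots> < 0" using n d qpos[OF that] by (intro mult_pos_neg) (auto simp: d_def)
      finally show False using p[of "- q w y / d"] by simp
    qed
  qed
  have "g (m *\<^sub>R w - S w) y = q w y" for y by (simp add: q_def gl)
  moreover have "m *\<^sub>R w - S w \<in> U"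
    using wU S(2) U(1) by (simp add: subspace_diff subspace_scale)
  ultimately have "g (m *\<^sub>R w - S w) (m *\<^sub>R w - S w) = 0" "m *\<^sub>R w - S w \<in> U"
    using q0[of "m *\<^sub>R w - S w"] by simp_all
  then have Sw: "S w = m *\<^sub>R w" using pos[of "m *\<^sub>R w - S w"] by fastforce
  show thesis
  proof (rule that[of "(1 / sqrt (g w w)) *\<^sub>R w" m])
    show "(1 / sqrt (g w w)) *\<^sub>R w \<in> U" using wU U(1) by (simp add: subspace_scale)
    show "g ((1 / sqrt (g w w)) *\<^sub>R w) ((1 / sqrt (g w w)) *\<^sub>R w) = 1" using w0 by (simp add: gl)
    show "S ((1 / sqrt (g w w)) *\<^sub>R w) = m *\<^sub>R (1 / sqrt (g w w)) *\<^sub>R w"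
      by (simp add: linear_scale[OF S(1)] Sw)
  qed
qed

text \<open>\<open>hijk\<close> stands for \<open>F\<close> on the i-th, j-th and k-th vectors of
  three planes rotated by \<open>br t\<close> with frequencies \<open>a\<close>, \<open>b\<close>,
  \<open>c\<close>. The equations \<open>lin\<close> are invariance under \<open>br t\<close>;
  \<open>ab\<close>, \<open>ac\<close>, \<open>bc\<close> are Jacobi identities whose left sides are
  the contribution of \<open>t\<close>. At most one weight component survives, and then the timelike
  sign gives \<open>a\<^sup>2 + 2 * N = 0\<close> with \<open>N \<ge> 0\<close>.\<close>

lemma three_weights_contradiction:
  fixes a b c :: real
  assumes nz: "a \<noteq> 0" "b \<noteq> 0" "c \<noteq> 0"
    and lin: "a * h211 + b * h121 + c * h112 = 0" "- a * h111 + b * h221 + c * h212 = 0"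
      "a * h221 - b * h111 + c * h122 = 0" "a * h212 + b * h122 - c * h111 = 0"
      "- a * h121 - b * h211 + c * h222 = 0" "- a * h112 + b * h222 - c * h211 = 0"
      "a * h222 - b * h112 - c * h121 = 0" "- a * h122 - b * h212 - c * h221 = 0"
    and ab: "a * b = - (h111 * h221 + h112 * h222) + h121 * h211 + h122 * h212"
    and ac: "a * c = - (h111 * h212 + h121 * h222) + h112 * h211 + h122 * h221"
    and bc: "b * c = - (h111 * h122 + h211 * h222) + h112 * h121 + h212 * h221"
  shows False
proof -
  \<comment> \<open>Real and imaginary parts of the component of weight \<open>a + s b + u c\<close> under three commuting
    rotations with frequencies \<open>a\<close>, \<open>b\<close>, \<open>c\<close>; at most one of the four weights can vanish.\<close>
  define R where "R s u = h111 - s * h221 - u * h212 - s * u * h122" for s u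
  define I where "I s u = h211 + s * h121 + u * h112 - s * u * h222" for s u
  have weight: "a + s * b + u * c = 0 \<or> R s u = 0 \<and> I s u = 0" if "s \<in> {1, -1}" "u \<in> {1, -1}" for s u
  proof -
    have "(a + s * b + u * c) * R s u = 0" "(a + s * b + u * c) * I s u = 0"
      using that lin unfolding R_def I_def by (auto simp: algebra_simps)
    then show ?thesis by auto
  qed
  have concl: False
    if su: "s \<in> {1, -1}" "u \<in> {1, -1}"
    and z: "R s (-u) = 0" "R (-s) u = 0" "R (-s) (-u) = 0" "I s (-u) = 0" "I (-s) u = 0" "I (-s) (-u) = 0"
    and w: "a + s * b + u * c = 0 \<or> R s u = 0 \<and> I s u = 0" for s u
  proof -
    \<comment> \<open>Three vanishing weight components express everything through
      \<open>h111\<close> and \<open>h211\<close>.\<close>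
    have h: "h221 = - s * h111" "h212 = - u * h111" "h122 = - (s * u) * h111"
      "h121 = s * h211" "h112 = u * h211" "h222 = - (s * u) * h211"
      using su z unfolding R_def I_def by auto
    have sq: "s * s = 1" "u * u = 1" using su by auto
    define N where "N = 2 * (h111\<^sup>2 + h211\<^sup>2)"
    have N: "a * b = s * N" "a * c = u * N"
      unfolding ab ac h N_def using su by (auto simp: power2_eq_square algebra_simps)
    show False using w
    proof
      assume "a + s * b + u * c = 0"
      then have "a * (a + s * b + u * c) = 0" by simp
      then have "a\<^sup>2 + s * (a * b) + u * (a * c) = 0" by (simp add: power2_eq_square algebra_simps)
      then have "a\<^sup>2 + (s * s) * N + (u * u) * N = 0" unfolding N by (simp add: algebra_simps)
      then have "a\<^sup>2 + 2 * N = 0" unfolding sq by simp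
      moreover have "a\<^sup>2 > 0" "N \<ge> 0" using nz by (auto simp: N_def)
      ultimately show False by linarith
    next
      assume "R s u = 0 \<and> I s u = 0"
      then have "h111 = 0" "h211 = 0" unfolding R_def I_def h using su by auto
      then show False using N nz by (simp add: N_def)
    qed
  qed
  \<comment> \<open>Two vanishing weights would make one of \<open>a\<close>, \<open>b\<close>,
    \<open>c\<close> zero. The last case covers the weight \<open>a - b - c\<close>, whether it
    vanishes or not.\<close>
  consider "a + b + c = 0" | "a + b - c = 0" | "a - b + c = 0" |
    "a + b + c \<noteq> 0" "a + b - c \<noteq> 0" "a - b + c \<noteq> 0" by blast
  then show False
  proof cases
    case 1
    then show False using nz weight[of 1 "-1"] weight[of "-1" 1] weight[of "-1" "-1"]
      by (intro concl[of 1 1]) auto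
  next
    case 2
    then show False using nz weight[of 1 1] weight[of "-1" 1] weight[of "-1" "-1"]
      by (intro concl[of 1 "-1"]) auto
  next
    case 3
    then show False using nz weight[of 1 1] weight[of 1 "-1"] weight[of "-1" "-1"]
      by (intro concl[of "-1" 1]) auto
  next
    case 4
    then show False using nz weight[of 1 1] weight[of 1 "-1"] weight[of "-1" 1] weight[of "-1" "-1"]
      by (intro concl[of "-1" "-1"]) auto
  qed
qed

text \<open>The right side of the theorem in terms of vectors; zero vectors account for a zero
  summand, so planes need not be mentioned.\<close>

definition orthogonal_sum :: "('v::real_vector \<Rightarrow> 'v \<Rightarrow> real) \<Rightarrow> 'v form3 \<Rightarrow> bool" where
  "orthogonal_sum g F \<longleftrightarrow> (\<exists>a1 a2 a3 b1 b2 b3. (\<forall>a\<in>{a1,a2,a3}. \<forall>b\<in>{b1,b2,b3}. g a b = 0) \<and>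
     F = vol g a1 a2 a3 + vol g b1 b2 b3)"

lemma orthogonal_sumI:
  assumes "F = vol g a1 a2 a3 + vol g b1 b2 b3" "\<And>a b. a \<in> {a1, a2, a3} \<Longrightarrow> b \<in> {b1, b2, b3} \<Longrightarrow> g a b = 0"
  shows "orthogonal_sum g F"
  unfolding orthogonal_sum_def using assms by blast

section \<open>Lie algebras with an invariant inner product\<close>

text \<open>\<open>jacobi\<close> says that every \<open>br x\<close> annihilates \<open>F\<close>;
  with \<open>g_br\<close> this is the Jacobi identity for \<open>br\<close>. The signature is left
  open so that \<open>- g\<close> can take the place of \<open>g\<close>.\<close>

locale metric_lie =
  fixes g :: "'v::real_vector \<Rightarrow> 'v \<Rightarrow> real" and F :: "'v form3" and br :: "'v \<Rightarrow> 'v \<Rightarrow> 'v"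
  assumes bil: "bilinear g" and sym: "g x y = g y x" and nondeg: "(\<And>y. g x y = 0) \<Longrightarrow> x = 0"
    and form3: "is_form3 F" and g_br: "g (br x y) z = F x y z"
    and jacobi: "F (br x y) z w + F y (br x z) w + F y z (br x w) = 0"
begin

lemmas gl = bilinear_ladd[OF bil] bilinear_radd[OF bil] bilinear_lmul[OF bil] bilinear_rmul[OF bil]
    bilinear_lsub[OF bil] bilinear_rsub[OF bil] bilinear_lzero[OF bil] bilinear_rzero[OF bil]
    bilinear_lneg[OF bil] bilinear_rneg[OF bil]

lemma F_linear: "linear (\<lambda>x. F x y z)" "linear (\<lambda>y. F x y z)" "linear (F x y)"
  using form3 unfolding is_form3_def by auto

lemmas Fl = F_linear[THEN linear_add] F_linear[THEN linear_scale] F_linear[THEN linear_diff]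
  F_linear[THEN linear_0] F_linear[THEN linear_neg]

lemma F_alt [simp]: "F x x y = 0" "F x y x = 0" "F y x x = 0"
  using form3 unfolding is_form3_def by auto

lemmas F_swap = form3_swap[OF form3]

lemma F_rot: "F y z x = F x y z" "F z x y = F x y z"
  using F_swap[of y x z] F_swap[of y z x] F_swap[of x z y] F_swap(1)[of z x y] by auto

lemma eqI: "(\<And>z. g x z = g y z) \<Longrightarrow> x = y"
  using nondeg[of "x - y"] by (simp add: gl)

lemma br_lin: "br (x + y) z = br x z + br y z" "br z (x + y) = br z x + br z y"
  "br (c *\<^sub>R x) z = c *\<^sub>R br x z" "br z (c *\<^sub>R x) = c *\<^sub>R br z x"
  "br (x - y) z = br x z - br y z" "br z (x - y) = br z x - br z y"
  by (rule eqI; simp add: gl g_br Fl)+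

lemma linear_br: "linear (br x)" by (intro linearI) (simp_all add: br_lin)

lemma br_skew: "g (br t x) y = - g x (br t y)"
  using F_swap(2)[of t x y] sym[of x "br t y"] by (simp add: g_br)

text \<open>By the Jacobi identity the commutator of \<open>br s\<close> and \<open>br t\<close> is
  \<open>br (br s t)\<close>.\<close>

lemma br_commute:
  assumes "br s t = 0" shows "br s (br t x) = br t (br s x)"
proof (rule eqI)
  fix z
  have "F (br s t) x z + F t (br s x) z + F t x (br s z) = 0" by (rule jacobi)
  moreover have "F t x (br s z) = - g (br s (br t x)) z" using br_skew[of s "br t x" z] unfolding g_br by linarith
  ultimately show "g (br s (br t x)) z = g (br t (br s x)) z" using assms by (simp add: Fl g_br)
qed

text \<open>In the action of \<open>br t\<close> on \<open>F d x y\<close> only the term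
  \<open>a * F e x y\<close> survives.\<close>

lemma F_plane_kernel_kernel:
  assumes "br t d = a *\<^sub>R e" "a \<noteq> 0" "br t x = 0" "br t y = 0"
  shows "F e x y = 0"
  using jacobi[of t d x y] assms by (simp add: Fl)

text \<open>\<open>br t\<close> rotates the plane of \<open>e1\<close>, \<open>e2\<close> within
  itself, so it acts on \<open>F e1 e2 d\<close> through \<open>d\<close> alone.\<close>

lemma F_plane_other:
  assumes "br t e1 = a *\<^sub>R e2" "br t e2 = - a *\<^sub>R e1" "br t d = b *\<^sub>R e" "b \<noteq> 0"
  shows "F e1 e2 e = 0"
  using jacobi[of t e1 e2 d] assms by (simp add: Fl)

text \<open>The mixed components are rotated with frequencies \<open>a + b\<close> and
  \<open>a - b\<close>, both nonzero here; the proof solves the resulting two-by-two systems,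
  nonsingular as \<open>a\<^sup>2 \<noteq> b\<^sup>2\<close>.\<close>

lemma F_planes_kernel:
  assumes "br t e1 = a *\<^sub>R e2" "br t e2 = - a *\<^sub>R e1" "br t e3 = b *\<^sub>R e4" "br t e4 = - b *\<^sub>R e3"
    "br t x = 0" "a\<^sup>2 \<noteq> b\<^sup>2"
  shows "F e1 e3 x = 0" "F e1 e4 x = 0" "F e2 e3 x = 0" "F e2 e4 x = 0"
proof -
  have *: "p = 0 \<and> q = 0" if "a * q = b * p" "a * p = b * q" for p q :: real
  proof -
    have "(a\<^sup>2 - b\<^sup>2) * p = 0" "(a\<^sup>2 - b\<^sup>2) * q = 0" using that by algebra+
    then show ?thesis using assms(6) by simp
  qed
  have "a * F e2 e4 x = b * F e1 e3 x" "a * F e1 e3 x = b * F e2 e4 x"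
    using jacobi[of t e1 e4 x] jacobi[of t e2 e3 x] assms by (simp_all add: Fl)
  from *[OF this] show "F e1 e3 x = 0" "F e2 e4 x = 0" by auto
  have "a * (- F e2 e3 x) = b * F e1 e4 x" "a * F e1 e4 x = b * (- F e2 e3 x)"
    using jacobi[of t e1 e3 x] jacobi[of t e2 e4 x] assms by (simp_all add: Fl)
  from *[OF this] show "F e1 e4 x = 0" "F e2 e3 x = 0" by auto
qed

lemma F_perms: "F y x z = - F x y z" "F x z y = - F x y z" "F y z x = F x y z" "F z x y = F x y z"
  "F z y x = - F x y z"
  using F_swap(1)[of y x z] F_swap(2)[of x y z] F_rot[of x y z] F_swap(1)[of z y x] by auto

text \<open>\<open>P\<close> projects orthogonally to the plane. Components of \<open>F\<close> with
  exactly one argument in the plane vanish by \<open>z\<close>; those with two make up the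
  \<open>vol\<close> term.\<close>

lemma F_plane_split:
  assumes on: "g d d = 1" "g e e = 1" "g d e = 0"
    and z: "\<And>y z. g y d = 0 \<Longrightarrow> g y e = 0 \<Longrightarrow> g z d = 0 \<Longrightarrow> g z e = 0 \<Longrightarrow> F d y z = 0 \<and> F e y z = 0"
    and P: "\<And>x. P x = x - g x d *\<^sub>R d - g x e *\<^sub>R e"
  shows "F x y z = F (P x) (P y) (P z) + vol g (br d e) d e x y z"
proof -
  have Pd: "g (P x) d = 0" "g (P x) e = 0" for x
    using on sym[of e d] by (simp_all add: P gl)
  have PP: "F d (P y) (P z) = 0" "F e (P y) (P z) = 0" for y z using z[OF Pd Pd] by auto
  have PP': "F (P y) d (P z) = 0" "F (P y) e (P z) = 0" "F (P y) (P z) d = 0" "F (P y) (P z) e = 0" for y z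
    using F_perms[of d "P y" "P z"] F_perms[of e "P y" "P z"] PP by auto
  define c where "c = F d e"
  have de: "F d e (P x) = c x" "F e d (P x) = - c x" "F d (P x) e = - c x" "F e (P x) d = c x"
    "F (P x) d e = c x" "F (P x) e d = - c x" for x
  proof -
    show *: "F d e (P x) = c x" by (simp add: P Fl c_def)
    show "F e d (P x) = - c x" "F d (P x) e = - c x" "F e (P x) d = c x"
    "F (P x) d e = c x" "F (P x) e d = - c x"
      using F_perms[of d e "P x"] * by simp_all
  qed
  have "x = P x + g x d *\<^sub>R d + g x e *\<^sub>R e" for x by (simp add: P)
  then have "F x y z = F (P x + g x d *\<^sub>R d + g x e *\<^sub>R e) (P y + g y d *\<^sub>R d + g y e *\<^sub>R e)
      (P z + g z d *\<^sub>R d + g z e *\<^sub>R e)" by presburger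
  also have "\<dots> = F (P x) (P y) (P z) + c x * (g y d * g z e - g z d * g y e)
      - c y * (g x d * g z e - g z d * g x e) + c z * (g x d * g y e - g y d * g x e)"
    by (simp add: Fl PP PP' de algebra_simps)
  finally show ?thesis
    unfolding wedge12_def wedge11_def by (simp add: g_br c_def sym[of d] sym[of e] algebra_simps)
qed

end

section \<open>The action of a timelike vector\<close>

text \<open>\<open>basis\<close> both fixes the dimension at 7 and provides the coordinates for
  \<open>ex_symmetric_eigenvector\<close>; \<open>pos\<close> makes the complement of
  \<open>t\<close> definite.\<close>

locale timelike_metric_lie = metric_lie g F br
  for g :: "'v::real_vector \<Rightarrow> 'v \<Rightarrow> real" and F :: "'v form3" and br :: "'v \<Rightarrow> 'v \<Rightarrow> 'v" +
  fixes t :: "'v::real_vector" and basis :: "7 \<Rightarrow> 'v"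
  assumes basis: "inj basis" "independent (range basis)" "span (range basis) = UNIV"
    and tt: "g t t = -1" and pos: "g t x = 0 \<Longrightarrow> x \<noteq> 0 \<Longrightarrow> g x x > 0"
begin

section \<open>Orthonormal systems in the complement of \<open>t\<close>\<close>

fun orthonormal :: "'v list \<Rightarrow> bool" where
  "orthonormal [] \<longleftrightarrow> True"
| "orthonormal (x # xs) \<longleftrightarrow> g t x = 0 \<and> g x x = 1 \<and> (\<forall>y\<in>set xs. g x y = 0) \<and> orthonormal xs"

lemma orthonormalD: "orthonormal es \<Longrightarrow> e \<in> set es \<Longrightarrow> g t e = 0 \<and> g e e = 1"
  by (induction es) auto

lemma orthonormal_independent:
  "orthonormal es \<Longrightarrow> independent (insert t (set es)) \<and> card (insert t (set es)) = Suc (length es)"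
proof (induction es)
  case Nil
  have "t \<noteq> 0" using tt by (auto simp: gl)
  then show ?case by simp
next
  case (Cons x xs)
  have sub: "subspace {y. g x y = 0}" by (auto simp: subspace_def gl)
  have "insert t (set xs) \<subseteq> {y. g x y = 0}" using Cons.prems sym by auto
  then have "span (insert t (set xs)) \<subseteq> {y. g x y = 0}" by (rule span_minimal[OF _ sub])
  moreover have "g x x = 1" using Cons.prems by simp
  ultimately have x: "x \<notin> span (insert t (set xs))" by auto
  then have x': "x \<notin> insert t (set xs)" using span_base by blast
  have e: "insert t (set (x # xs)) = insert x (insert t (set xs))" by auto
  have IH: "independent (insert t (set xs))" "card (insert t (set xs)) = Suc (length xs)"
    using Cons by auto
  show ?case unfolding e using IH x x' by (simp add: independent_insert)
qed

lemma orthonormal_length_le: "orthonormal es \<Longrightarrow> length es \<le> 6"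
proof -
  assume "orthonormal es"
  note * = orthonormal_independent[OF this]
  have "card (insert t (set es)) \<le> card (range basis)"
    using independent_span_bound[of "range basis" "insert t (set es)"] * basis(3) by simp
  then have "Suc (length es) \<le> card (range basis)" using * by simp
  also have "\<dots> = 7" using basis(1) by (simp add: card_image)
  finally show ?thesis by simp
qed

text \<open>The projection orthogonal to \<open>t\<close> and \<open>es\<close>; the
  \<open>t\<close> term enters with a plus sign because \<open>g t t = -1\<close>.\<close>

definition residue :: "'v list \<Rightarrow> 'v \<Rightarrow> 'v" where
  "residue es x = x + g x t *\<^sub>R t - (\<Sum>e\<leftarrow>es. g x e *\<^sub>R e)"

lemma residue_orthogonal:
  assumes "orthonormal es"
  shows "g (residue es x) t = 0" "e \<in> set es \<Longrightarrow> g (residue es x) e = 0"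
proof -
  have 1: "g (\<Sum>e\<leftarrow>es. g x e *\<^sub>R e) y = (\<Sum>e\<leftarrow>es. g x e * g e y)" for y
    by (induction es) (auto simp: gl)
  have "(\<Sum>e\<leftarrow>es. g x e * g e t) = 0"
    using assms by (induction es) (auto simp: sym[of _ t])
  then show "g (residue es x) t = 0" by (simp add: residue_def gl 1 tt)
  have "(\<Sum>d\<leftarrow>es. g x d * g d e) = g x e" if "e \<in> set es" for e
    using assms that
  proof (induction es)
    case (Cons d es)
    show ?case
    proof (cases "e \<in> set es")
      case True then show ?thesis using Cons by auto
    next
      case False
      then have "e = d" using Cons by simp
      moreover have "(\<Sum>c\<leftarrow>es. g x c * g c d) = 0"
      proof -
        have "g c d = 0" if "c \<in> set es" for c
          using Cons.prems(1) that sym[of c d] by simp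
        then have "(\<Sum>c\<leftarrow>es. g x c * g c d) = (\<Sum>c\<leftarrow>es. 0)"
          by (intro arg_cong[where f = sum_list] map_cong) auto
        then show ?thesis by simp
      qed
      ultimately show ?thesis using Cons.prems by simp
    qed
  qed simp
  then show "g (residue es x) e = 0" if "e \<in> set es"
    using that orthonormalD[OF assms that] by (simp add: residue_def gl 1)
qed

lemma orthonormal_extend_by:
  assumes "orthonormal es" "x \<noteq> 0" "g t x = 0" "\<And>e. e \<in> set es \<Longrightarrow> g x e = 0"
  shows "orthonormal ((1 / sqrt (g x x)) *\<^sub>R x # es)"
  using assms pos[of x] by (simp add: gl)

text \<open>A nonzero residue would normalise to a seventh vector, against
  \<open>orthonormal_length_le\<close>.\<close>

lemma expand:
  assumes "orthonormal es" "length es = 6"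
  shows "x = (\<Sum>e\<leftarrow>es. g x e *\<^sub>R e) - g x t *\<^sub>R t"
proof -
  have "residue es x = 0"
  proof (rule ccontr)
    assume r: "residue es x \<noteq> 0"
    have "g t (residue es x) = 0" using residue_orthogonal(1)[OF assms(1), of x] sym[of t] by metis
    from orthonormal_length_le[OF orthonormal_extend_by[OF assms(1) r this residue_orthogonal(2)[OF assms(1)]]]
    show False using assms(2) by simp
  qed
  then show ?thesis by (simp add: residue_def algebra_simps)
qed

text \<open>Gram-Schmidt: a vector outside the span of \<open>t\<close> and \<open>es\<close> has
  nonzero residue.\<close>

lemma orthonormal_extend:
  assumes "orthonormal es" "length es < 6"
  obtains f where "orthonormal (f # es)"
proof -
  let ?S = "insert t (set es)"
  have "span ?S \<noteq> UNIV"
  proof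
    assume "span ?S = UNIV"
    then have "card (range basis) \<le> card ?S" using independent_span_bound[of ?S "range basis"] basis(2) by simp
    moreover have "card (range basis) = 7" using basis(1) by (simp add: card_image)
    ultimately show False using orthonormal_independent[OF assms(1)] assms(2) by simp
  qed
  then obtain x where x: "x \<notin> span ?S" by blast
  have "(\<Sum>e\<leftarrow>ds. g x e *\<^sub>R e) \<in> span ?S" if "set ds \<subseteq> set es" for ds
    using that by (induction ds) (auto intro: span_add span_scale span_base span_zero)
  then have "(\<Sum>e\<leftarrow>es. g x e *\<^sub>R e) - g x t *\<^sub>R t \<in> span ?S"
    by (auto intro!: span_diff span_scale intro: span_base)
  moreover have "x = (\<Sum>e\<leftarrow>es. g x e *\<^sub>R e) - g x t *\<^sub>R t" if "residue es x = 0"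
    using that by (simp add: residue_def algebra_simps)
  ultimately have "residue es x \<noteq> 0" using x by auto
  moreover have "g t (residue es x) = 0"
    using residue_orthogonal(1)[OF assms(1), of x] sym[of t] by metis
  ultimately show thesis
    using that orthonormal_extend_by[OF assms(1) _ _ residue_orthogonal(2)[OF assms(1)]] by blast
qed

section \<open>Planes rotated by \<open>br t\<close>\<close>

lemma range_spacelike: "x \<in> range (br t) \<Longrightarrow> g t x = 0"
  by (auto simp: sym[of t] g_br)

lemma ex_eigenvector:
  assumes "subspace U" "U \<noteq> {0}" "U \<subseteq> range (br t)"
    "linear S" "\<And>x. x \<in> U \<Longrightarrow> S x \<in> U"
      "\<And>x y. x \<in> U \<Longrightarrow> y \<in> U \<Longrightarrow> g (S x) y = g x (S y)"
  obtains v m where "v \<in> U" "g v v = 1" "S v = m *\<^sub>R v"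
  by (rule ex_symmetric_eigenvector[OF bil sym basis assms(1,2) _ assms(4,5,6)])
    (use assms(3) range_spacelike pos in blast)+

text \<open>The frequency may be zero or negative, as can happen for a second derivation
  \<open>br f\<close>.\<close>

definition rotates :: "'v \<Rightarrow> 'v \<Rightarrow> 'v \<Rightarrow> real \<Rightarrow> bool" where
  "rotates x d e a \<longleftrightarrow> br x d = a *\<^sub>R e \<and> br x e = - a *\<^sub>R d"

text \<open>The square of the skew map \<open>br t\<close> is symmetric and so has an eigenvector
  \<open>v\<close> in \<open>U\<close>; \<open>v\<close> and the normalised \<open>br t v\<close>
  span the plane.\<close>

lemma ex_rotated_plane:
  assumes U: "subspace U" "U \<noteq> {0}" "U \<subseteq> range (br t)" "\<And>x. x \<in> U \<Longrightarrow> br t x \<in> U"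
  obtains d e a where "d \<in> U" "e \<in> U" "g d d = 1" "g e e = 1" "g d e = 0" "a \<noteq> 0" "rotates t d e a"
proof -
  have lin: "linear (\<lambda>x. br t (br t x))"
    using linear_compose[OF linear_br[of t] linear_br[of t]] by (simp add: o_def)
  obtain v m where v: "v \<in> U" "g v v = 1" "br t (br t v) = m *\<^sub>R v"
    by (rule ex_eigenvector[OF U(1-3) lin]) (auto simp: U(4) br_skew)
  obtain w where w: "v = br t w" using v U(3) by blast
  \<comment> \<open>The kernel of a skew map is orthogonal to its range, which contains
    \<open>v\<close>.\<close>
  have t0: "br t v \<noteq> 0"
  proof
    assume "br t v = 0"
    then have "g v v = 0" using br_skew[of t w v] w by (simp add: gl)
    then show False using v by simp
  qed
  have pos': "g (br t v) (br t v) > 0"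
    using pos[OF range_spacelike t0] by simp
  have m: "m = - g (br t v) (br t v)"
    using br_skew[of t "br t v" v] v by (simp add: gl)
  define a where "a = sqrt (g (br t v) (br t v))"
  have a: "a > 0" "a * a = g (br t v) (br t v)" using pos' by (auto simp: a_def)
  show thesis
  proof (rule that[of v "(1 / a) *\<^sub>R br t v" a])
    show "g ((1 / a) *\<^sub>R br t v) ((1 / a) *\<^sub>R br t v) = 1"
      using a(1) by (simp add: gl a(2)[symmetric])
    show "g v ((1 / a) *\<^sub>R br t v) = 0"
      using g_br[of t v v] sym[of v "br t v"] by (simp add: gl)
    show "rotates t v ((1 / a) *\<^sub>R br t v) a"
      using a m v(3) by (simp add: rotates_def br_lin field_simps)
    show "(1 / a) *\<^sub>R br t v \<in> U" using U v by (simp add: subspace_scale)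
  qed (use v a in auto)
qed

text \<open>With a single frequency, the composite of \<open>br t\<close> with a commuting \<open>br f\<close> is symmetric,
  and its eigenvectors span planes rotated by both.\<close>

lemma ex_jointly_rotated_plane:
  assumes U: "subspace U" "U \<noteq> {0}" "U \<subseteq> range (br t)" "\<And>x. x \<in> U \<Longrightarrow> br t x \<in> U"
      "\<And>x. x \<in> U \<Longrightarrow> br f x \<in> U"
    and f: "br t f = 0" and a: "a \<noteq> 0" "\<And>x. x \<in> range (br t) \<Longrightarrow> br t (br t x) = - (a\<^sup>2) *\<^sub>R x"
  obtains d e k where "d \<in> U" "e \<in> U" "g d d = 1" "g e e = 1" "g d e = 0"
    "rotates t d e a" "rotates f d e k"
proof -
  have lin: "linear (\<lambda>x. br t (br f x))"
    using linear_compose[OF linear_br[of f] linear_br[of t]] by (simp add: o_def)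
  obtain v m where v: "v \<in> U" "g v v = 1" "br t (br f v) = m *\<^sub>R v"
    by (rule ex_eigenvector[OF U(1-3) lin]) (auto simp: U(4,5) br_skew br_commute[OF f])
  have vr: "v \<in> range (br t)" "br f v \<in> range (br t)" using v U by auto
  \<comment> \<open>A further \<open>br t\<close> makes \<open>br f v\<close> a multiple of
    \<open>br t v\<close>, since \<open>br t\<close> squares to the scalar
    \<open>- (a\<^sup>2)\<close> on its range.\<close>
  have "br t (br t (br f v)) = m *\<^sub>R br t v" unfolding v(3) by (simp add: br_lin)
  then have *: "(a\<^sup>2) *\<^sub>R br f v = - m *\<^sub>R br t v" using a(2)[OF vr(2)]
    by (simp add: neg_eq_iff_add_eq_0 eq_neg_iff_add_eq_0)
  define e where "e = (1 / a) *\<^sub>R br t v"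
  have tv: "br t v = a *\<^sub>R e" using a by (simp add: e_def)
  have te: "br t e = - a *\<^sub>R v" using a a(2)[OF vr(1)]
    by (simp add: e_def br_lin power2_eq_square)
  have fv: "br f v = (- m / a) *\<^sub>R e"
  proof -
    have "br f v = (1 / a\<^sup>2) *\<^sub>R (a\<^sup>2) *\<^sub>R br f v" using a by simp
    also have "\<dots> = (- m / a) *\<^sub>R e" unfolding * tv using a by (simp add: power2_eq_square)
    finally show ?thesis .
  qed
  have "br f e = (1 / a) *\<^sub>R br t (br f v)"
    unfolding e_def by (simp add: br_lin br_commute[OF f])
  also have "\<dots> = - (- m / a) *\<^sub>R v" unfolding v(3) by simp
  finally have fe: "br f e = - (- m / a) *\<^sub>R v" .
  have "g (br t v) (br t v) = a\<^sup>2" using br_skew[of t v "br t v"] a(2)[OF vr(1)] v(2) by (simp add: gl)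
  then have "g e e = 1" unfolding e_def using a by (simp add: gl power2_eq_square)
  moreover have "g v e = 0" using g_br[of t v v] sym[of v "br t v"] by (simp add: gl e_def)
  moreover have "e \<in> U" using U v by (simp add: e_def subspace_scale)
  ultimately show thesis using that[of v e "- m / a"] v tv te fv fe by (simp add: rotates_def)
qed

text \<open>Taken inside \<open>range (br t)\<close>, so that it becomes \<open>{0}\<close> once the
  rotated planes exhaust what \<open>br t\<close> moves.\<close>

definition complement :: "'v list \<Rightarrow> 'v set" where
  "complement es = {x \<in> range (br t). \<forall>e\<in>set es. g x e = 0}"

lemma subspace_complement: "subspace (complement es)"
proof -
  have "subspace (range (br t))" by (intro linear_subspace_image linear_br subspace_UNIV)
  then show ?thesis by (auto simp: complement_def subspace_def gl)
qed

text \<open>Skewness carries the invariance of the plane over to its complement.\<close>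

lemma rotated_orthogonal:
  assumes "rotates x d e a" "g y d = 0" "g y e = 0"
  shows "g (br x y) d = 0" "g (br x y) e = 0"
  using assms br_skew[of x y d] br_skew[of x y e] by (simp_all add: rotates_def gl)

lemma kernel_if_no_complement:
  assumes "complement es = {0}" "\<And>y. \<forall>e\<in>set es. g y e = 0 \<Longrightarrow> \<forall>e\<in>set es. g (br t y) e = 0"
    "\<forall>e\<in>set es. g x e = 0"
  shows "br t x = 0"
  using assms by (auto simp: complement_def)

section \<open>Exclusion of three planes\<close>

lemma inner_expand:
  assumes "orthonormal es" "length es = 6"
  shows "g x y = (\<Sum>e\<leftarrow>es. g x e * g y e) - g x t * g y t"
proof -
  have "g (\<Sum>e\<leftarrow>ds. g x e *\<^sub>R e) y = (\<Sum>e\<leftarrow>ds. g x e * g y e)" for ds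
    by (induction ds) (auto simp: gl sym)
  then show ?thesis by (subst expand[OF assms, of x]) (simp add: gl sym[of y t])
qed

text \<open>The Jacobi identity for \<open>e1\<close>, \<open>e2\<close>, \<open>e3\<close>,
  \<open>e4\<close>, expanded in the orthonormal basis. The product \<open>a * b\<close> is the
  contribution of \<open>t\<close>, whose inner products with \<open>br e1 e2\<close> and
  \<open>br e3 e4\<close> are \<open>a\<close> and \<open>b\<close>.\<close>

lemma three_planes_jacobi:
  assumes on: "orthonormal [e1, e2, e3, e4, e5, e6]"
    and rot: "rotates t e1 e2 a" "rotates t e3 e4 b" "rotates t e5 e6 c"
    and nz: "a \<noteq> 0" "b \<noteq> 0" "c \<noteq> 0"
  shows "a * b = - (F e1 e3 e5 * F e2 e4 e5 + F e1 e3 e6 * F e2 e4 e6)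
      + F e1 e4 e5 * F e2 e3 e5 + F e1 e4 e6 * F e2 e3 e6"
proof -
  note r = rot[unfolded rotates_def]
  have z: "F e1 e2 e3 = 0" "F e1 e2 e4 = 0" "F e1 e2 e5 = 0" "F e1 e2 e6 = 0"
    "F e3 e4 e1 = 0" "F e3 e4 e2 = 0"
    using F_plane_other[of t e1 a e2 e4 "- b" e3] F_plane_other[of t e1 a e2 e3 b e4]
      F_plane_other[of t e1 a e2 e6 "- c" e5] F_plane_other[of t e1 a e2 e5 c e6]
      F_plane_other[of t e3 b e4 e2 "- a" e1] F_plane_other[of t e3 b e4 e1 a e2] r nz by auto
  have s: "F e1 e3 e2 = 0" "F e1 e3 e4 = 0" "F e1 e4 e2 = 0" "F e1 e4 e3 = 0"
    "F e2 e3 e1 = 0" "F e2 e3 e4 = 0" "F e2 e4 e1 = 0" "F e2 e4 e3 = 0"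
    using z F_swap(2)[of e1 e2 e3] F_swap(2)[of e1 e2 e4] F_rot[of e1 e2 e3] F_rot[of e1 e2 e4]
      F_rot[of e3 e4 e1] F_rot[of e3 e4 e2] F_swap(2)[of e1 e3 e4] F_swap(2)[of e2 e3 e4] by auto
  have ft: "F x y t = g (br t x) y" for x y using F_rot[of t x y] by (simp add: g_br)
  have tz: "F e1 e3 t = 0" "F e1 e4 t = 0" "F e2 e3 t = 0" "F e2 e4 t = 0"
    "F e1 e2 t = a" "F e3 e4 t = b"
    using r on sym[of e3 e2] sym[of e3 e1] unfolding ft by (auto simp: gl)
  \<comment> \<open>By invariance this is the inner product of \<open>br x y\<close> and
    \<open>br z w\<close>; the coordinate along \<open>t\<close> counts negatively.\<close>
  have q: "F (br x y) z w = (\<Sum>e\<leftarrow>[e1, e2, e3, e4, e5, e6]. F x y e * F z w e) - F x y t * F z w t"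
    for x y z w
  proof -
    have "F (br x y) z w = F z w (br x y)" by (rule F_rot(1)[symmetric])
    also have "\<dots> = g (br x y) (br z w)" by (rule trans[OF g_br[symmetric] sym])
    also have "\<dots> = (\<Sum>e\<leftarrow>[e1, e2, e3, e4, e5, e6]. g (br x y) e * g (br z w) e)
        - g (br x y) t * g (br z w) t" by (rule inner_expand[OF on]) simp
    finally show ?thesis unfolding g_br .
  qed
  have "F (br e1 e2) e3 e4 + F e2 (br e1 e3) e4 + F e2 e3 (br e1 e4) = 0" by (rule jacobi)
  moreover have "F (br e1 e2) e3 e4 = - (a * b)"
    unfolding q by (simp add: z tz)
  moreover have "F e2 (br e1 e3) e4 = - (F e1 e3 e5 * F e2 e4 e5 + F e1 e3 e6 * F e2 e4 e6)"
    unfolding F_swap(1)[where X = "br e1 e3" and Y = e2] q by (simp add: z tz s)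
  moreover have "F e2 e3 (br e1 e4) = F e1 e4 e5 * F e2 e3 e5 + F e1 e4 e6 * F e2 e3 e6"
    unfolding F_rot(1)[where x = "br e1 e4" and y = e2] q by (simp add: z tz s)
  ultimately show ?thesis by linarith
qed

text \<open>The three pairs of planes give the identities \<open>ab\<close>, \<open>ac\<close>,
  \<open>bc\<close>; the linear equations come from the action of \<open>br t\<close> on the eight
  components with one vector from each plane.\<close>

lemma no_three_planes:
  assumes on: "orthonormal [e1, e2, e3, e4, e5, e6]"
    and rot: "rotates t e1 e2 a" "rotates t e3 e4 b" "rotates t e5 e6 c"
    and nz: "a \<noteq> 0" "b \<noteq> 0" "c \<noteq> 0"
  shows False
proof (rule three_weights_contradiction[OF nz])
  have on': "orthonormal [e1, e2, e5, e6, e3, e4]" "orthonormal [e3, e4, e5, e6, e1, e2]"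
    using on by (auto simp: sym)
  show "a * b = - (F e1 e3 e5 * F e2 e4 e5 + F e1 e3 e6 * F e2 e4 e6)
      + F e1 e4 e5 * F e2 e3 e5 + F e1 e4 e6 * F e2 e3 e6"
    by (rule three_planes_jacobi[OF on rot nz])
  show "a * c = - (F e1 e3 e5 * F e2 e3 e6 + F e1 e4 e5 * F e2 e4 e6)
      + F e1 e3 e6 * F e2 e3 e5 + F e1 e4 e6 * F e2 e4 e5"
    using three_planes_jacobi[OF on'(1) rot(1,3,2) nz(1,3,2)]
    unfolding F_swap(2)[of _ _ e3] F_swap(2)[of _ _ e4] by (simp add: algebra_simps)
  show "b * c = - (F e1 e3 e5 * F e1 e4 e6 + F e2 e3 e5 * F e2 e4 e6)
      + F e1 e3 e6 * F e1 e4 e5 + F e2 e3 e6 * F e2 e4 e5"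
    using three_planes_jacobi[OF on'(2) rot(2,3,1) nz(2,3,1)]
    unfolding F_rot(1)[where x = e1] F_rot(1)[where x = e2] by (simp add: algebra_simps)
qed (use jacobi[of t e1 e3 e5] jacobi[of t e2 e3 e5] jacobi[of t e1 e4 e5] jacobi[of t e1 e3 e6]
    jacobi[of t e2 e4 e5] jacobi[of t e2 e3 e6] jacobi[of t e1 e4 e6] jacobi[of t e2 e4 e6]
    rot[unfolded rotates_def] in \<open>simp_all add: Fl\<close>)

lemma orthonormal_plane_append:
  assumes "orthonormal es" "d \<in> complement es" "e \<in> complement es" "g d d = 1" "g e e = 1" "g d e = 0"
  shows "orthonormal (d # e # es)"
  using assms range_spacelike by (auto simp: complement_def)

text \<open>The residue of \<open>x\<close> stays in the range and is orthogonal to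
  \<open>es\<close>, hence lies in the zero complement.\<close>

lemma range_expand:
  assumes on: "orthonormal es" and c: "complement es = {0}" "set es \<subseteq> range (br t)" and x: "x \<in> range (br t)"
  shows "x = (\<Sum>e\<leftarrow>es. g x e *\<^sub>R e)"
proof -
  have sub: "subspace (range (br t))" by (intro linear_subspace_image linear_br subspace_UNIV)
  have "(\<Sum>e\<leftarrow>ds. g x e *\<^sub>R e) \<in> range (br t)" if "set ds \<subseteq> range (br t)" for ds
    using that
  proof (induction ds)
    case Nil
    show ?case using subspace_0[OF sub] by simp
  next
    case (Cons d ds)
    then show ?case using subspace_add[OF sub subspace_scale[OF sub]] by simp
  qed
  then have "(\<Sum>e\<leftarrow>es. g x e *\<^sub>R e) \<in> range (br t)" using c by blast
  moreover have xt: "g x t = 0" using range_spacelike[OF x] sym[of x t] by simp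
  ultimately have "residue es x \<in> range (br t)" using x subspace_diff[OF sub] by (simp add: residue_def)
  then have "residue es x \<in> complement es"
    using residue_orthogonal(2)[OF on] by (simp add: complement_def)
  then show ?thesis using c xt by (simp add: residue_def)
qed

lemma F_timelike_kernel:
  assumes "br t x = 0"
  shows "F t x y = 0" "F x t y = 0" "F x y t = 0" "F t y x = 0" "F y t x = 0" "F y x t = 0"
proof -
  show "F t x y = 0" using assms g_br[of t x y] by (simp add: gl)
  then show "F x t y = 0" "F x y t = 0" "F t y x = 0" "F y t x = 0" "F y x t = 0"
    using F_perms[of t x y] by simp_all
qed

section \<open>One rotated plane\<close>

text \<open>Orthogonally to the plane, \<open>t\<close> contributes nothing to \<open>F\<close>,
  which leaves a 3-form in four dimensions. Such a form is annihilated by its Hodge dual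
  vector.\<close>

lemma ex_isotropy:
  assumes on: "orthonormal [e1, e2]"
    and ker: "\<And>x. g x e1 = 0 \<Longrightarrow> g x e2 = 0 \<Longrightarrow> br t x = 0"
  obtains f where "orthonormal [f, e1, e2]"
    "\<And>y z. g y e1 = 0 \<Longrightarrow> g y e2 = 0 \<Longrightarrow> g z e1 = 0 \<Longrightarrow> g z e2 = 0 \<Longrightarrow> F f y z = 0"
proof -
  obtain p1 where p1: "orthonormal [p1, e1, e2]" using orthonormal_extend[OF on] by auto
  obtain p2 where p2: "orthonormal [p2, p1, e1, e2]" using orthonormal_extend[OF p1] by auto
  obtain p3 where p3: "orthonormal [p3, p2, p1, e1, e2]" using orthonormal_extend[OF p2] by auto
  obtain p4 where p4: "orthonormal [p4, p3, p2, p1, e1, e2]" using orthonormal_extend[OF p3] by auto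
  \<comment> \<open>The vector corresponding to \<open>F\<close> restricted to the span of \<open>p1\<close>, ..., \<open>p4\<close> under the Hodge star.\<close>
  define n where "n = F p2 p3 p4 *\<^sub>R p1 - F p1 p3 p4 *\<^sub>R p2 + F p1 p2 p4 *\<^sub>R p3 - F p1 p2 p3 *\<^sub>R p4"
  have ne: "g n e1 = 0" "g n e2 = 0" "g t n = 0" using p4 by (auto simp: n_def gl)
  have perms: "F x p2 p1 = - F x p1 p2" "F x p3 p1 = - F x p1 p3" "F x p3 p2 = - F x p2 p3"
      "F x p4 p1 = - F x p1 p4" "F x p4 p2 = - F x p2 p4" "F x p4 p3 = - F x p3 p4" for x
    by (rule F_swap(2))+
  have np: "F n p1 p2 = 0" "F n p1 p3 = 0" "F n p1 p4 = 0" "F n p2 p3 = 0" "F n p2 p4 = 0" "F n p3 p4 = 0"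
    using F_perms[of p1 p2 p3] F_perms[of p1 p2 p4] F_perms[of p1 p3 p4] F_perms[of p2 p3 p4]
    by (simp_all add: n_def Fl)
  have ker4: "F p4 y z = 0" if "n = 0" "y \<in> {p1, p2, p3}" "z \<in> {p1, p2, p3}" for y z
  proof -
    have "g n p1 = F p2 p3 p4" "g n p2 = - F p1 p3 p4" "g n p3 = F p1 p2 p4"
      using p4 by (auto simp: n_def gl sym[of p1 p2] sym[of p1 p3] sym[of p1 p4] sym[of p2 p3]
        sym[of p2 p4] sym[of p3 p4])
    then show ?thesis
      using that F_perms[of p1 p2 p4] F_perms[of p1 p3 p4] F_perms[of p2 p3 p4] by (auto simp: gl)
  qed
  have ex: "y = g y p1 *\<^sub>R p1 + g y p2 *\<^sub>R p2 + g y p3 *\<^sub>R p3 + g y p4 *\<^sub>R p4 - g y t *\<^sub>R t"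
    if "g y e1 = 0" "g y e2 = 0" for y
    using expand[OF p4, of y] that by (simp add: algebra_simps)
  have kill: "F x y z = 0" if x: "br t x = 0" "F x p1 p2 = 0" "F x p1 p3 = 0" "F x p1 p4 = 0" "F x p2 p3 = 0"
      "F x p2 p4 = 0" "F x p3 p4 = 0"
    and y: "g y e1 = 0" "g y e2 = 0" and z: "g z e1 = 0" "g z e2 = 0" for x y z
    by (subst ex[OF y], subst ex[OF z])
      (simp add: Fl x perms[of x] F_timelike_kernel[OF x(1)])
  show thesis
  \<comment> \<open>For \<open>n = 0\<close> the restricted form vanishes, and any of the four unit
    vectors would do.\<close>
  proof (cases "n = 0")
    case True
    have on4: "orthonormal [p4, e1, e2]" using p4 by simp
    have k4: "br t p4 = 0" by (rule ker) (use on4 in simp_all)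
    show thesis
    proof (rule that[OF on4])
      show "F p4 y z = 0" if "g y e1 = 0" "g y e2 = 0" "g z e1 = 0" "g z e2 = 0" for y z
        by (rule kill[OF k4 _ _ _ _ _ _ that]) (simp_all add: ker4[OF True])
    qed
  next
    case False
    let ?c = "1 / sqrt (g n n)"
    have "orthonormal [?c *\<^sub>R n, e1, e2]"
      by (rule orthonormal_extend_by[OF on False]) (use ne in auto)
    moreover have "F (?c *\<^sub>R n) y z = 0"
      if "g y e1 = 0" "g y e2 = 0" "g z e1 = 0" "g z e2 = 0" for y z
      using kill[of n, OF ker[OF ne(1,2)] np that] by (simp add: Fl)
    ultimately show thesis using that by blast
  qed
qed

text \<open>The directions \<open>t\<close> and \<open>f4\<close> drop out of \<open>F\<close>
  orthogonally to the plane, so there it is a multiple of the volume form of \<open>f1\<close>,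
  \<open>f2\<close>, \<open>f3\<close>; \<open>F_plane_split\<close> adds the summand of the plane
  itself.\<close>

lemma orthogonal_sum_one_plane:
  assumes on: "orthonormal [e1, e2]" and rot: "rotates t e1 e2 a" "a \<noteq> 0"
    and ker: "\<And>x. g x e1 = 0 \<Longrightarrow> g x e2 = 0 \<Longrightarrow> br t x = 0"
  shows "orthogonal_sum g F"
proof -
  obtain f4 where f4: "orthonormal [f4, e1, e2]"
    "\<And>y z. g y e1 = 0 \<Longrightarrow> g y e2 = 0 \<Longrightarrow> g z e1 = 0 \<Longrightarrow> g z e2 = 0 \<Longrightarrow> F f4 y z = 0"
    using ex_isotropy[OF on ker] by blast
  obtain f1 where f1: "orthonormal [f1, f4, e1, e2]" using orthonormal_extend[OF f4(1)] by auto
  obtain f2 where f2: "orthonormal [f2, f1, f4, e1, e2]" using orthonormal_extend[OF f1] by auto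
  obtain f3 where f3: "orthonormal [f3, f2, f1, f4, e1, e2]" using orthonormal_extend[OF f2] by auto
  define p where "p = F f1 f2 f3"
  have fe: "g f1 e1 = 0" "g f1 e2 = 0" "g f2 e1 = 0" "g f2 e2 = 0" "g f3 e1 = 0" "g f3 e2 = 0"
    using f3 by auto
  have slot: "F u v w = g u f1 * F f1 v w + g u f2 * F f2 v w + g u f3 * F f3 v w"
    if u: "g u e1 = 0" "g u e2 = 0" and v: "g v e1 = 0" "g v e2 = 0" and w: "g w e1 = 0" "g w e2 = 0" for u v w
  proof -
    have "u = g u f1 *\<^sub>R f1 + g u f2 *\<^sub>R f2 + g u f3 *\<^sub>R f3 + g u f4 *\<^sub>R f4 - g u t *\<^sub>R t"
      using expand[OF f3, of u] u by (simp add: algebra_simps)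
    then have "F u v w = F (g u f1 *\<^sub>R f1 + g u f2 *\<^sub>R f2 + g u f3 *\<^sub>R f3 + g u f4 *\<^sub>R f4 - g u t *\<^sub>R t) v w"
      by simp
    then show ?thesis using f4(2)[OF v w] F_timelike_kernel(1)[OF ker[OF v]] by (simp add: Fl)
  qed
  have det: "F u v w = vol g (p *\<^sub>R f1) f2 f3 u v w"
    if u: "g u e1 = 0" "g u e2 = 0" and v: "g v e1 = 0" "g v e2 = 0" and w: "g w e1 = 0" "g w e2 = 0" for u v w
  proof -
    have 3: "F f f' w = g w f1 * F f1 f f' + g w f2 * F f2 f f' + g w f3 * F f3 f f'"
      if f: "f \<in> {f1, f2, f3}" "f' \<in> {f1, f2, f3}" for f f'
      using slot[OF w, of f f'] f fe F_rot(1)[of f f' w] by auto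
    have 2: "F f v w = - (g v f1 * F f1 f w + g v f2 * F f2 f w + g v f3 * F f3 f w)"
      if f: "f \<in> {f1, f2, f3}" for f
      using slot[OF v, of f w] f fe w F_swap(1)[of f v w] by auto
    have pp: "F f2 f1 f3 = - p" "F f1 f3 f2 = - p" "F f2 f3 f1 = p" "F f3 f1 f2 = p" "F f3 f2 f1 = - p"
      using F_perms[of f1 f2 f3] by (simp_all add: p_def)
    show ?thesis unfolding slot[OF u v w] wedge12_def wedge11_def
      by (simp add: 2 3 pp p_def[symmetric] gl sym[of f1 u] sym[of f1 v] sym[of f1 w] sym[of f2 u] sym[of f2 v]
        sym[of f2 w] sym[of f3 u] sym[of f3 v] sym[of f3 w] algebra_simps)
  qed
  define P where "P x = x - g x e1 *\<^sub>R e1 - g x e2 *\<^sub>R e2" for x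
  have on2: "g e1 e1 = 1" "g e2 e2 = 1" "g e1 e2 = 0" "g e2 e1 = 0" using on sym[of e2 e1] by auto
  have Pe: "g (P x) e1 = 0" "g (P x) e2 = 0" for x using on2 by (simp_all add: P_def gl)
  have r: "br t e1 = a *\<^sub>R e2" "br t e2 = (- a) *\<^sub>R e1" using rot by (auto simp: rotates_def)
  have Pf: "g f (P x) = g f x" if "f \<in> {f1, f2, f3}" for f x
    using that fe by (auto simp: P_def gl)
  have "F x y z = vol g (br e1 e2) e1 e2 x y z + vol g (p *\<^sub>R f1) f2 f3 x y z" for x y z
  proof -
    have "F x y z = F (P x) (P y) (P z) + vol g (br e1 e2) e1 e2 x y z"
    proof (rule F_plane_split[OF on2(1-3) _ P_def])
      fix y z assume "g y e1 = 0" "g y e2 = 0" "g z e1 = 0" "g z e2 = 0"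
      then have k: "br t y = 0" "br t z = 0" using ker by auto
      show "F e1 y z = 0 \<and> F e2 y z = 0"
        using F_plane_kernel_kernel[OF r(1) rot(2) k] F_plane_kernel_kernel[OF r(2) _ k] rot(2) by simp
    qed
    also have "F (P x) (P y) (P z) = vol g (p *\<^sub>R f1) f2 f3 (P x) (P y) (P z)"
      by (rule det) (rule Pe)+
    also have "\<dots> = vol g (p *\<^sub>R f1) f2 f3 x y z" by (simp add: wedge12_def wedge11_def gl Pf)
    finally show ?thesis by simp
  qed
  then have F: "F = vol g (br e1 e2) e1 e2 + vol g (p *\<^sub>R f1) f2 f3"
    by (intro ext) simp
  define w where "w = br e1 e2"
  have w: "g w e1 = 0" "g w e2 = 0" by (simp_all add: w_def g_br)
  \<comment> \<open>The components of \<open>br u e1\<close> and \<open>br u e2\<close> outside the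
    plane vanish, which leaves a rotation of the plane at rate \<open>F u e1 e2\<close>.\<close>
  have act: "br u e1 = F u e1 e2 *\<^sub>R e2" "br u e2 = - F u e1 e2 *\<^sub>R e1"
    if u: "g u e1 = 0" "g u e2 = 0" for u
  proof -
    have h: "F e1 u (P z) = 0" "F e2 u (P z) = 0" for z
      using F_plane_kernel_kernel[OF r(1) rot(2) ker[OF u] ker[OF Pe]]
        F_plane_kernel_kernel[OF r(2) _ ker[OF u] ker[OF Pe]] rot(2) by simp_all
    have d: "z = P z + g z e1 *\<^sub>R e1 + g z e2 *\<^sub>R e2" for z by (simp add: P_def)
    have F: "F u e1 z = F u e1 e2 * g z e2" "F u e2 z = - F u e1 e2 * g z e1" for z
    proof -
      have "F u e1 (P z) = 0" "F u e2 (P z) = 0" "F u e2 e1 = - F u e1 e2"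
        using h[of z] F_swap(1)[of u e1 "P z"] F_swap(1)[of u e2 "P z"] F_swap(2)[of u e2 e1] by simp_all
      then show "F u e1 z = F u e1 e2 * g z e2" "F u e2 z = - F u e1 e2 * g z e1"
        by (subst d[of z], simp add: Fl)+
    qed
    show "br u e1 = F u e1 e2 *\<^sub>R e2"
    proof (rule eqI)
      show "g (br u e1) z = g (F u e1 e2 *\<^sub>R e2) z" for z
        using F(1)[of z] sym[of e2 z] unfolding g_br gl by simp
    qed
    show "br u e2 = - F u e1 e2 *\<^sub>R e1"
    proof (rule eqI)
      show "g (br u e2) z = g (- F u e1 e2 *\<^sub>R e1) z" for z
        using F(2)[of z] sym[of e1 z] unfolding g_br gl by simp
    qed
  qed
  \<comment> \<open>\<open>br u\<close> rotates the plane, so its action on the last two arguments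
    of \<open>F v e1 e2\<close> is zero; what remains of \<open>jacobi\<close> says that
    \<open>br u v\<close> is orthogonal to \<open>w\<close>.\<close>
  have comm: "F u v w = 0" if "g u e1 = 0" "g u e2 = 0" "g v e1 = 0" "g v e2 = 0" for u v
  proof -
    have "F (br u v) e1 e2 = 0"
      using jacobi[of u v e1 e2] act[OF that(1,2)] by (simp add: Fl)
    then have "g (br e1 e2) (br u v) = 0" using F_rot(1)[of e1 e2 "br u v"] by (simp add: g_br)
    then show ?thesis using sym[of w "br u v"] by (simp add: w_def g_br)
  qed
  show ?thesis
  \<comment> \<open>For \<open>p = 0\<close> the second summand is rewritten with zero vectors,
    because then nothing forces \<open>f1\<close>, \<open>f2\<close>, \<open>f3\<close> to be
    orthogonal to \<open>w\<close>.\<close>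
  proof (cases "p = 0")
    case True
    then have "vol g (p *\<^sub>R f1) f2 f3 = vol g 0 0 0"
      by (intro ext) (simp add: wedge12_def wedge11_def gl)
    then have "F = vol g (br e1 e2) e1 e2 + vol g 0 0 0" using F by simp
    then show ?thesis by (rule orthogonal_sumI) (auto simp: gl)
  next
    case False
    \<comment> \<open>\<open>F f1 f2 w\<close> equals \<open>p * g f3 w\<close>, and
      cyclically.\<close>
    have "p * g f3 w = 0" "p * g f2 w = 0" "p * g f1 w = 0"
      using comm[of f1 f2] comm[of f3 f1] comm[of f2 f3] f3 fe w det[of f1 f2 w] det[of f3 f1 w] det[of f2 f3 w]
      by (auto simp: wedge12_def wedge11_def gl sym[of f1 f2] sym[of f1 f3] sym[of f2 f3])
    then have "g w f1 = 0" "g w f2 = 0" "g w f3 = 0" using False sym[of w] by auto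
    moreover have "g e1 f1 = 0" "g e1 f2 = 0" "g e1 f3 = 0" "g e2 f1 = 0" "g e2 f2 = 0" "g e2 f3 = 0"
      using fe sym by metis+
    ultimately show ?thesis by (intro orthogonal_sumI[OF F[folded w_def]]) (auto simp: gl)
  qed
qed

section \<open>Two rotated planes\<close>

text \<open>A nonzero complement would contain a third rotated plane.\<close>

lemma two_planes_kernel:
  assumes on: "orthonormal [e3, e4, e1, e2]"
    and rot: "rotates t e1 e2 a" "rotates t e3 e4 b" and nz: "a \<noteq> 0" "b \<noteq> 0"
  shows "complement [e3, e4, e1, e2] = {0}"
    "g x e1 = 0 \<Longrightarrow> g x e2 = 0 \<Longrightarrow> g x e3 = 0 \<Longrightarrow> g x e4 = 0 \<Longrightarrow> br t x = 0"
proof -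
  have stable: "\<forall>e\<in>set [e3, e4, e1, e2]. g (br t y) e = 0" if "\<forall>e\<in>set [e3, e4, e1, e2]. g y e = 0" for y
    using that rotated_orthogonal[OF rot(1), of y] rotated_orthogonal[OF rot(2), of y] by simp
  show c: "complement [e3, e4, e1, e2] = {0}"
  proof (rule ccontr)
    let ?U = "complement [e3, e4, e1, e2]"
    assume n: "?U \<noteq> {0}"
    have r: "?U \<subseteq> range (br t)" by (auto simp: complement_def)
    have inv: "br t x \<in> ?U" if "x \<in> ?U" for x using that stable[of x] by (simp add: complement_def)
    obtain d e c where de: "d \<in> ?U" "e \<in> ?U" "g d d = 1" "g e e = 1" "g d e = 0" "c \<noteq> 0" "rotates t d e c"
      using ex_rotated_plane[OF subspace_complement n r inv] by blast
    from orthonormal_plane_append[OF on de(1-5)] no_three_planes[of d e e3 e4 e1 e2] rot nz de(6,7)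
    show False by blast
  qed
  show "br t x = 0" if "g x e1 = 0" "g x e2 = 0" "g x e3 = 0" "g x e4 = 0"
    by (rule kernel_if_no_complement[OF c stable]) (use that in simp_all)
qed

text \<open>The kernel of \<open>br t\<close> is orthogonal to both planes, hence spanned by
  \<open>f1\<close>, \<open>f2\<close>, \<open>t\<close>; the one possible component contains
  \<open>t\<close> and vanishes.\<close>

lemma two_planes_F_kernel:
  assumes on: "orthonormal [e3, e4, e1, e2]"
    and rot: "rotates t e1 e2 a" "rotates t e3 e4 b" and nz: "a \<noteq> 0" "b \<noteq> 0"
    and x: "br t x = 0" and y: "br t y = 0" and z: "br t z = 0"
  shows "F x y z = 0"
proof -
  obtain f1 where f1: "orthonormal [f1, e3, e4, e1, e2]" using orthonormal_extend[OF on] by auto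
  obtain f2 where f2: "orthonormal [f2, f1, e3, e4, e1, e2]" using orthonormal_extend[OF f1] by auto
  have e0: "g u e1 = 0" "g u e2 = 0" "g u e3 = 0" "g u e4 = 0" if "br t u = 0" for u
    using that br_skew[of t u e1] br_skew[of t u e2] br_skew[of t u e3] br_skew[of t u e4] rot nz
    by (auto simp: rotates_def gl)
  have ex: "u = g u f1 *\<^sub>R f1 + g u f2 *\<^sub>R f2 - g u t *\<^sub>R t" if "br t u = 0" for u
    using expand[OF f2, of u] e0[OF that] by (simp add: algebra_simps)
  have "br t f1 = 0" "br t f2 = 0"
    using f2 by (auto intro!: two_planes_kernel(2)[OF on rot nz])
  then show ?thesis
    by (subst ex[OF x], subst ex[OF y], subst ex[OF z]) (simp add: Fl F_timelike_kernel)
qed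

text \<open>By \<open>mixed\<close>, the kernel of \<open>br t\<close> does not mix the two planes.
  Splitting off one plane after the other then leaves \<open>F\<close> on the kernel, which is zero
  by \<open>two_planes_F_kernel\<close>.\<close>

lemma orthogonal_sum_two_planes:
  assumes on: "orthonormal [e3, e4, e1, e2]"
    and rot: "rotates t e1 e2 a" "rotates t e3 e4 b" and nz: "a \<noteq> 0" "b \<noteq> 0"
    and mixed: "\<And>x. br t x = 0 \<Longrightarrow> F e1 e3 x = 0 \<and> F e1 e4 x = 0 \<and> F e2 e3 x = 0 \<and> F e2 e4 x = 0"
  shows "orthogonal_sum g F"
proof -
  note ker = two_planes_kernel(2)[OF on rot nz]
  have r: "br t e1 = a *\<^sub>R e2" "br t e2 = (- a) *\<^sub>R e1" "br t e3 = b *\<^sub>R e4" "br t e4 = (- b) *\<^sub>R e3"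
    using rot by (auto simp: rotates_def)
  have "F e1 e2 e3 = 0" "F e1 e2 e4 = 0" "F e3 e4 e1 = 0" "F e3 e4 e2 = 0"
    using F_plane_other[of t e1 a e2 e4 "- b" e3] F_plane_other[of t e1 a e2 e3 b e4]
      F_plane_other[of t e3 b e4 e2 "- a" e1] F_plane_other[of t e3 b e4 e1 a e2] r nz by auto
  then have z: "F e1 e3 e2 = 0" "F e1 e4 e2 = 0" "F e2 e3 e1 = 0" "F e2 e4 e1 = 0"
    "F e1 e3 e4 = 0" "F e1 e4 e3 = 0" "F e2 e3 e4 = 0" "F e2 e4 e3 = 0"
    "F e1 e2 e3 = 0" "F e1 e2 e4 = 0" "F e3 e4 e1 = 0" "F e3 e4 e2 = 0"
    using F_perms[of e1 e2 e3] F_perms[of e1 e2 e4] F_perms[of e3 e4 e1] F_perms[of e3 e4 e2] by simp_all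
  have n: "g e1 e1 = 1" "g e2 e2 = 1" "g e3 e3 = 1" "g e4 e4 = 1"
    "g e1 e2 = 0" "g e3 e4 = 0" "g e2 e1 = 0" "g e4 e3 = 0" "g e3 e1 = 0" "g e3 e2 = 0" "g e4 e1 = 0" "g e4 e2 = 0"
    "g e1 e3 = 0" "g e2 e3 = 0" "g e1 e4 = 0" "g e2 e4 = 0"
    using on sym[of e1 e3] sym[of e2 e3] sym[of e1 e4] sym[of e2 e4] sym[of e2 e1] sym[of e4 e3] by auto
  define H where "H x = x - g x e1 *\<^sub>R e1 - g x e2 *\<^sub>R e2 - g x e3 *\<^sub>R e3 - g x e4 *\<^sub>R e4" for x
  have kH: "br t (H x) = 0" for x by (rule ker) (simp_all add: H_def gl n)
  have d: "x = H x + g x e1 *\<^sub>R e1 + g x e2 *\<^sub>R e2 + g x e3 *\<^sub>R e3 + g x e4 *\<^sub>R e4" for x by (simp add: H_def)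
  have mixed': "F e1 e3 x = 0" "F e1 e4 x = 0" "F e2 e3 x = 0" "F e2 e4 x = 0" for x
    using mixed[OF kH[of x]] by (subst d[of x], simp add: Fl z)+
  have mm: "F e1 x e3 = 0" "F e1 x e4 = 0" "F e2 x e3 = 0" "F e2 x e4 = 0"
    "F e3 e1 x = 0" "F e4 e1 x = 0" "F e3 e2 x = 0" "F e4 e2 x = 0"
    "F e3 x e1 = 0" "F e4 x e1 = 0" "F e3 x e2 = 0" "F e4 x e2 = 0" for x
    using mixed'[of x] F_perms[of e1 e3 x] F_perms[of e2 e3 x] F_perms[of e1 e4 x] F_perms[of e2 e4 x]
    by simp_all
  have hh: "F e1 (H x) (H y) = 0" "F e2 (H x) (H y) = 0" "F e3 (H x) (H y) = 0" "F e4 (H x) (H y) = 0" for x y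
    using F_plane_kernel_kernel[OF r(1) _ kH kH] F_plane_kernel_kernel[OF r(2) _ kH kH]
      F_plane_kernel_kernel[OF r(3) _ kH kH] F_plane_kernel_kernel[OF r(4) _ kH kH] nz by simp_all
  define P where "P x = x - g x e1 *\<^sub>R e1 - g x e2 *\<^sub>R e2" for x
  define Q where "Q x = x - g x e3 *\<^sub>R e3 - g x e4 *\<^sub>R e4" for x
  have QP: "Q (P x) = H x" for x by (simp add: Q_def P_def H_def gl n algebra_simps)
  have "F x y z = vol g (br e1 e2) e1 e2 x y z + vol g (br e3 e4) e3 e4 x y z" for x y z
  proof -
    have "F x y z = F (P x) (P y) (P z) + vol g (br e1 e2) e1 e2 x y z"
    proof (rule F_plane_split[OF n(1,2,5) _ P_def])
      fix y z assume a: "g y e1 = 0" "g y e2 = 0" "g z e1 = 0" "g z e2 = 0"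
      have "y = H y + g y e3 *\<^sub>R e3 + g y e4 *\<^sub>R e4" "z = H z + g z e3 *\<^sub>R e3 + g z e4 *\<^sub>R e4"
        using a by (simp_all add: H_def)
      then have "F e1 y z = F e1 (H y + g y e3 *\<^sub>R e3 + g y e4 *\<^sub>R e4) (H z + g z e3 *\<^sub>R e3 + g z e4 *\<^sub>R e4)"
        "F e2 y z = F e2 (H y + g y e3 *\<^sub>R e3 + g y e4 *\<^sub>R e4) (H z + g z e3 *\<^sub>R e3 + g z e4 *\<^sub>R e4)" by auto
      then show "F e1 y z = 0 \<and> F e2 y z = 0" by (simp add: Fl hh mixed' mm)
    qed
    also have "F (P x) (P y) (P z) = F (Q (P x)) (Q (P y)) (Q (P z)) + vol g (br e3 e4) e3 e4 (P x) (P y) (P z)"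
    proof (rule F_plane_split[OF n(3,4,6) _ Q_def])
      fix y z assume a: "g y e3 = 0" "g y e4 = 0" "g z e3 = 0" "g z e4 = 0"
      have "y = H y + g y e1 *\<^sub>R e1 + g y e2 *\<^sub>R e2" "z = H z + g z e1 *\<^sub>R e1 + g z e2 *\<^sub>R e2"
        using a by (simp_all add: H_def)
      then have "F e3 y z = F e3 (H y + g y e1 *\<^sub>R e1 + g y e2 *\<^sub>R e2) (H z + g z e1 *\<^sub>R e1 + g z e2 *\<^sub>R e2)"
        "F e4 y z = F e4 (H y + g y e1 *\<^sub>R e1 + g y e2 *\<^sub>R e2) (H z + g z e1 *\<^sub>R e1 + g z e2 *\<^sub>R e2)" by auto
      then show "F e3 y z = 0 \<and> F e4 y z = 0" by (simp add: Fl hh mixed' mm)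
    qed
    also have "F (Q (P x)) (Q (P y)) (Q (P z)) = 0"
      unfolding QP by (rule two_planes_F_kernel[OF on rot nz]) (rule kH)+
    \<comment> \<open>\<open>P\<close> alters only coordinates along \<open>e1\<close> and
      \<open>e2\<close>, to which all three factors of this form are orthogonal.\<close>
    also have "vol g (br e3 e4) e3 e4 (P x) (P y) (P z) = vol g (br e3 e4) e3 e4 x y z"
      by (simp add: wedge12_def wedge11_def P_def gl n g_br z Fl)
    finally show ?thesis by simp
  qed
  then have F: "F = vol g (br e1 e2) e1 e2 + vol g (br e3 e4) e3 e4" by (intro ext) simp
  \<comment> \<open>Since \<open>br e1\<close> kills \<open>e3\<close> and \<open>e4\<close>,
    \<open>jacobi\<close> reduces to \<open>F (br e1 e2) e3 e4 = 0\<close>, the orthogonality of the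
    two bracket vectors.\<close>
  have zero: "br e1 e3 = 0" "br e1 e4 = 0" by (rule nondeg, simp add: g_br mixed')+
  have "g (br e1 e2) (br e3 e4) = F (br e1 e2) e3 e4"
    using F_rot(1)[of e3 e4 "br e1 e2"] sym[of "br e1 e2"] by (simp add: g_br)
  also have "\<dots> = 0" using jacobi[of e1 e2 e3 e4] by (simp add: zero Fl)
  finally have "g (br e1 e2) (br e3 e4) = 0" .
  moreover have "g e1 (br e3 e4) = 0" "g e2 (br e3 e4) = 0"
    using sym[of _ "br e3 e4"] z by (simp_all add: g_br)
  ultimately show ?thesis by (intro orthogonal_sumI[OF F]) (auto simp: n g_br z)
qed

section \<open>Assembling the cases\<close>

lemma orthogonal_sum_if_noncentral:
  assumes "br t u \<noteq> 0"
  shows "orthogonal_sum g F"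
proof -
  have c0: "complement [] = range (br t)" by (simp add: complement_def)
  have inv: "br t x \<in> range (br t)" for x by blast
  have sub: "subspace (range (br t))" using subspace_complement[of "[]"] unfolding c0 .
  have nz: "range (br t) \<noteq> {0}" using assms by blast
  have stable: "br t x \<in> complement [d, e]" if "rotates t d e c" "x \<in> complement [d, e]" for d e c x
    using that rotated_orthogonal[OF that(1), of x] by (auto simp: complement_def)
  have one: "orthogonal_sum g F"
    if on: "orthonormal [d, e]" and rot: "rotates t d e c" "c \<noteq> 0" and c: "complement [d, e] = {0}" for d e c
  proof (rule orthogonal_sum_one_plane[OF on rot])
    fix x assume x: "g x d = 0" "g x e = 0"
    show "br t x = 0"
      by (rule kernel_if_no_complement[OF c]) (use x rotated_orthogonal[OF rot(1)] in auto)
  qed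
  have rc: "complement es \<subseteq> range (br t)" for es by (auto simp: complement_def)
  obtain e1 e2 a where e12: "g e1 e1 = 1" "g e2 e2 = 1" "g e1 e2 = 0" "a \<noteq> 0" "rotates t e1 e2 a"
    "e1 \<in> range (br t)" "e2 \<in> range (br t)"
    using ex_rotated_plane[OF sub nz order_refl inv] by metis
  have on12: "orthonormal [e1, e2]"
    using orthonormal_plane_append[of "[]" e1 e2] e12 by (simp add: c0)
  show ?thesis
  proof (cases "complement [e1, e2] = {0}")
    case True
    then show ?thesis by (rule one[OF on12 e12(5,4)])
  next
    case False
    obtain e3 e4 b where e34: "g e3 e3 = 1" "g e4 e4 = 1" "g e3 e4 = 0" "b \<noteq> 0" "rotates t e3 e4 b"
      "e3 \<in> complement [e1, e2]" "e4 \<in> complement [e1, e2]"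
      using ex_rotated_plane[OF subspace_complement False rc stable[OF e12(5)]] by metis
    have on: "orthonormal [e3, e4, e1, e2]"
      by (rule orthonormal_plane_append[OF on12]) (use e34 in auto)
    have e_range: "set [e3, e4, e1, e2] \<subseteq> range (br t)"
      using e12(6,7) e34(6,7) rc by auto
    note ker = two_planes_kernel[OF on e12(5) e34(5) e12(4) e34(4)]
    show ?thesis
    proof (cases "\<forall>x. br t x = 0 \<longrightarrow> F e1 e3 x = 0 \<and> F e1 e4 x = 0 \<and> F e2 e3 x = 0 \<and> F e2 e4 x = 0")
      case True
      then show ?thesis
        by (intro orthogonal_sum_two_planes[OF on e12(5) e34(5) e12(4) e34(4)]) blast
    next
      case False
      then obtain f where f: "br t f = 0"
        and nonzero: "\<not> (F e1 e3 f = 0 \<and> F e1 e4 f = 0 \<and> F e2 e3 f = 0 \<and> F e2 e4 f = 0)" by blast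
      have r: "br t e1 = a *\<^sub>R e2" "br t e2 = - a *\<^sub>R e1" "br t e3 = b *\<^sub>R e4" "br t e4 = - b *\<^sub>R e3"
        using e12(5) e34(5) by (auto simp: rotates_def)
      \<comment> \<open>Different squared frequencies would force every mixed component with
        \<open>f\<close> to vanish.\<close>
      have ab: "b\<^sup>2 = a\<^sup>2" using F_planes_kernel[OF r f] nonzero by metis
      have square: "br t (br t x) = - (a\<^sup>2) *\<^sub>R x" if "x \<in> range (br t)" for x
      proof -
        define x1 x2 x3 x4 where "x1 = g x e1" and "x2 = g x e2" and "x3 = g x e3" and "x4 = g x e4"
        have x: "x = x3 *\<^sub>R e3 + (x4 *\<^sub>R e4 + (x1 *\<^sub>R e1 + x2 *\<^sub>R e2))"
          using range_expand[OF on ker(1) e_range that] by (simp add: x1_def x2_def x3_def x4_def)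
        have sq: "br t (br t e1) = - (a\<^sup>2) *\<^sub>R e1" "br t (br t e2) = - (a\<^sup>2) *\<^sub>R e2"
          "br t (br t e3) = - (a\<^sup>2) *\<^sub>R e3" "br t (br t e4) = - (a\<^sup>2) *\<^sub>R e4"
          using ab by (simp_all add: r br_lin linear_neg[OF linear_br] power2_eq_square)
        show ?thesis unfolding x by (simp add: br_lin sq algebra_simps)
      qed
      have fr: "br f x \<in> range (br t)" if "x \<in> range (br t)" for x
        using that by (auto simp: br_commute[OF f, symmetric])
      obtain d1 d2 k where d12: "d1 \<in> range (br t)" "d2 \<in> range (br t)" "g d1 d1 = 1" "g d2 d2 = 1"
        "g d1 d2 = 0" "rotates t d1 d2 a" "rotates f d1 d2 k"
        using ex_jointly_rotated_plane[OF sub nz order_refl inv fr f e12(4) square] by metis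
      have ond12: "orthonormal [d1, d2]"
        using orthonormal_plane_append[of "[]" d1 d2] d12 by (simp add: c0)
      show ?thesis
      proof (cases "complement [d1, d2] = {0}")
        case True
        then show ?thesis by (rule one[OF ond12 d12(6) e12(4)])
      next
        case False
        have fc: "br f x \<in> complement [d1, d2]" if "x \<in> complement [d1, d2]" for x
          using that fr rotated_orthogonal[OF d12(7), of x] by (auto simp: complement_def)
        obtain d3 d4 l where d34: "d3 \<in> complement [d1, d2]" "d4 \<in> complement [d1, d2]" "g d3 d3 = 1"
          "g d4 d4 = 1" "g d3 d4 = 0" "rotates t d3 d4 a" "rotates f d3 d4 l"
          using ex_jointly_rotated_plane[OF subspace_complement False rc stable[OF d12(6)] fc f e12(4) square]
          by metis
        have ond: "orthonormal [d3, d4, d1, d2]"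
          by (rule orthonormal_plane_append[OF ond12]) (use d34 in auto)
        have d_range: "set [d3, d4, d1, d2] \<subseteq> range (br t)"
          using d12(1,2) d34(1,2) rc by auto
        note kerd = two_planes_kernel[OF ond d12(6) d34(6) e12(4) e12(4)]
        note Fkerd = two_planes_F_kernel[OF ond d12(6) d34(6) e12(4) e12(4)]
        have rd: "br t d1 = a *\<^sub>R d2" "br t d2 = - a *\<^sub>R d1" "br t d3 = a *\<^sub>R d4" "br t d4 = - a *\<^sub>R d3"
          "br f d1 = k *\<^sub>R d2" "br f d2 = - k *\<^sub>R d1" "br f d3 = l *\<^sub>R d4" "br f d4 = - l *\<^sub>R d3"
          using d12(6,7) d34(6,7) by (auto simp: rotates_def)
        show ?thesis
        proof (cases "k = l")
          case True
          \<comment> \<open>With equal rates \<open>br f\<close> is proportional to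
            \<open>br t\<close> on the range, so it does not mix the planes of \<open>e1\<close>,
            \<open>e2\<close> and \<open>e3\<close>, \<open>e4\<close>, against the choice of
            \<open>f\<close>.\<close>
          have fe: "br f x = (k / a) *\<^sub>R br t x" if "x \<in> range (br t)" for x
          proof -
            define x1 x2 x3 x4 where "x1 = g x d1" and "x2 = g x d2" and "x3 = g x d3" and "x4 = g x d4"
            have x: "x = x3 *\<^sub>R d3 + (x4 *\<^sub>R d4 + (x1 *\<^sub>R d1 + x2 *\<^sub>R d2))"
              using range_expand[OF ond kerd(1) d_range that] by (simp add: x1_def x2_def x3_def x4_def)
            show ?thesis unfolding x using e12(4) True by (simp add: br_lin rd algebra_simps)
          qed
          have eq: "F d e f = (k / a) * g (br t d) e" if "d \<in> range (br t)" for d e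
            using fe[OF that] F_rot(1)[of d e f] g_br[of f d e] by (simp add: gl)
          have "F e1 e3 f = 0" "F e1 e4 f = 0" "F e2 e3 f = 0" "F e2 e4 f = 0"
            using on e_range sym[of e1 e3] sym[of e1 e4] sym[of e2 e3] sym[of e2 e4]
            by (simp_all add: eq r gl)
          then show ?thesis using nonzero by blast
        next
          case False
          \<comment> \<open>\<open>x\<close> annihilates one plane and rotates the other, so it separates the two planes where \<open>t\<close> does not.\<close>
          define x where "x = f - (k / a) *\<^sub>R t"
          have rx: "br x d1 = 0 *\<^sub>R d2" "br x d2 = - 0 *\<^sub>R d1" "br x d3 = (l - k) *\<^sub>R d4" "br x d4 = - (l - k) *\<^sub>R d3"
            using e12(4) by (simp_all add: x_def br_lin rd algebra_simps)
          \<comment> \<open>\<open>F_planes_kernel\<close> for \<open>x\<close> in place of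
            \<open>t\<close> concerns vectors killed by \<open>br x\<close>. The kernel of
            \<open>br t\<close> is abelian, so \<open>br f\<close>, and with it \<open>br x\<close>,
            kills it.\<close>
          have kx: "br x y = 0" if y: "br t y = 0" for y
          proof -
            define H where "H z = z - g z d1 *\<^sub>R d1 - g z d2 *\<^sub>R d2 - g z d3 *\<^sub>R d3 - g z d4 *\<^sub>R d4" for z
            have n: "g d1 d1 = 1" "g d2 d2 = 1" "g d3 d3 = 1" "g d4 d4 = 1"
              "g d1 d2 = 0" "g d3 d4 = 0" "g d2 d1 = 0" "g d4 d3 = 0" "g d3 d1 = 0" "g d3 d2 = 0" "g d4 d1 = 0"
              "g d4 d2 = 0" "g d1 d3 = 0" "g d2 d3 = 0" "g d1 d4 = 0" "g d2 d4 = 0"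
              using ond sym[of d1 d3] sym[of d2 d3] sym[of d1 d4] sym[of d2 d4] sym[of d2 d1] sym[of d4 d3] by auto
            have kH: "br t (H z) = 0" for z by (rule kerd(2)) (simp_all add: H_def gl n)
            have d: "z = H z + g z d1 *\<^sub>R d1 + g z d2 *\<^sub>R d2 + g z d3 *\<^sub>R d3 + g z d4 *\<^sub>R d4" for z
              by (simp add: H_def)
            have "F d1 f y = 0" "F d2 f y = 0" "F d3 f y = 0" "F d4 f y = 0"
              using F_plane_kernel_kernel[OF rd(1) _ f y] F_plane_kernel_kernel[OF rd(2) _ f y]
                F_plane_kernel_kernel[OF rd(3) _ f y] F_plane_kernel_kernel[OF rd(4) _ f y] e12(4) by simp_all
            then have "F f y d1 = 0" "F f y d2 = 0" "F f y d3 = 0" "F f y d4 = 0"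
              using F_rot(1)[of f y] by simp_all
            then have "F f y z = 0" for z
              using Fkerd[OF f y kH[of z]] by (subst d[of z]) (simp add: Fl)
            then have "br f y = 0" by (intro nondeg) (simp add: g_br)
            then show ?thesis using y by (simp add: x_def br_lin)
          qed
          have "0\<^sup>2 \<noteq> (l - k)\<^sup>2" using False by simp
          then show ?thesis
            by (intro orthogonal_sum_two_planes[OF ond d12(6) d34(6) e12(4) e12(4)])
              (use F_planes_kernel[OF rx kx] in auto)
        qed
      qed
    qed
  qed
qed

end

section \<open>Orthogonal sums of simple forms\<close>

text \<open>Otherwise \<open>t\<close> and \<open>x\<close> would span a negative semidefinite
  plane, which meets the complement of the negative basis vector \<open>n\<close>, where
  \<open>g\<close> is positive definite.\<close>

lemma spacelike_if_orthogonal_timelike: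
  fixes g :: "'v::real_vector \<Rightarrow> 'v \<Rightarrow> real"
  assumes bil: "bilinear g" and sym: "\<And>x y. g x y = g y x" and sig: "has_signature g p 1"
    and t: "g t t < 0" and x: "g t x = 0" "x \<noteq> 0"
  shows "g x x > 0"
proof -
  note gl = bilinear_ladd[OF bil] bilinear_radd[OF bil] bilinear_lmul[OF bil] bilinear_rmul[OF bil]
    bilinear_lsub[OF bil] bilinear_rsub[OF bil] bilinear_lzero[OF bil] bilinear_rzero[OF bil]
  have lg: "linear (g y)" "linear (\<lambda>x. g x y)" for y using bil by (auto simp: bilinear_def)
  obtain P n where B: "finite P" "n \<notin> P" "span (insert n P) = UNIV"
    "pairwise (\<lambda>x y. g x y = 0) (insert n P)" "\<forall>x\<in>P. g x x > 0" "g n n < 0"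
  proof -
    obtain P N where "finite P" "P \<inter> N = {}" "card N = 1" "span (P \<union> N) = UNIV"
      "pairwise (\<lambda>x y. g x y = 0) (P \<union> N)" "\<forall>x\<in>P. g x x > 0" "\<forall>x\<in>N. g x x < 0"
      using sig unfolding has_signature_def by metis
    moreover then obtain n where "N = {n}" using card_1_singletonE by blast
    ultimately show thesis using that[of P n] by auto
  qed
  have perp: "g y y \<ge> 0 \<and> (g y y = 0 \<longrightarrow> y = 0)" if "g y n = 0" for y
  proof -
    obtain c where c: "y = (\<Sum>b\<in>insert n P. c b *\<^sub>R b)"
      using span_finite[of "insert n P"] B(1,3) by auto
    have gy: "g y b = c b * g b b" if "b \<in> insert n P" for b
    proof -
      have "g y b = (\<Sum>d\<in>insert n P. c d * g d b)" unfolding c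
        by (simp only: linear_sum[OF lg(2)] gl real_scaleR_def)
      also have "\<dots> = (\<Sum>d\<in>insert n P. if d = b then c b * g b b else 0)"
        by (rule sum.cong) (use B that in \<open>auto simp: pairwise_def\<close>)
      finally show ?thesis using B that by simp
    qed
    have "c n = 0" using gy[of n] that B by simp
    then have y: "y = (\<Sum>b\<in>P. c b *\<^sub>R b)" using c B by simp
    have "g y y = (\<Sum>b\<in>P. c b * g y b)"
      by (subst (2) y) (simp add: linear_sum[OF lg(1)] gl)
    also have "\<dots> = (\<Sum>b\<in>P. (c b)\<^sup>2 * g b b)"
      by (rule sum.cong) (use gy in \<open>auto simp: power2_eq_square\<close>)
    finally have e: "g y y = (\<Sum>b\<in>P. (c b)\<^sup>2 * g b b)" .
    have nn: "(c b)\<^sup>2 * g b b \<ge> 0" if "b \<in> P" for b using B(5) that by (simp add: less_imp_le)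
    have "y = 0" if "g y y = 0"
    proof -
      have "\<forall>b\<in>P. (c b)\<^sup>2 * g b b = 0"
        using that e sum_nonneg_eq_0_iff[OF B(1) nn] by simp
      then have "\<forall>b\<in>P. c b = 0" using B(5) by fastforce
      then show ?thesis using y by simp
    qed
    then show ?thesis using e nn by (auto intro!: sum_nonneg)
  qed
  show ?thesis
  proof (rule ccontr)
    assume "\<not> g x x > 0"
    then have xx: "g x x \<le> 0" by simp
    \<comment> \<open>The combination of \<open>t\<close> and \<open>x\<close> that is orthogonal to
      \<open>n\<close>.\<close>
    define y where "y = g x n *\<^sub>R t - g t n *\<^sub>R x"
    have "g y n = 0" by (simp add: y_def gl)
    note py = perp[OF this]
    have yy: "g y y = (g x n)\<^sup>2 * g t t + (g t n)\<^sup>2 * g x x"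
      using x(1) sym[of x t] by (simp add: y_def gl power2_eq_square algebra_simps)
    have 1: "(g x n)\<^sup>2 * g t t \<le> 0" "(g t n)\<^sup>2 * g x x \<le> 0"
      using t xx by (simp_all add: mult_nonneg_nonpos)
    then have "(g x n)\<^sup>2 * g t t = 0" "g y y = 0" using py yy by linarith+
    then have "g x n = 0" "y = 0" using t py by simp_all
    then have "g t n *\<^sub>R x = 0" by (simp add: y_def)
    then have "g t n = 0" using x(2) by simp
    then show False using perp[of t] t by simp
  qed
qed

lemma (in metric_lie) orthogonal_sum_if_signature:
  assumes sig: "has_signature g 6 1"
  shows "orthogonal_sum g F"
proof (cases "F = 0")
  case True
  then have "F = vol g 0 0 0 + vol g 0 0 0"
    by (intro ext) (simp add: wedge12_def wedge11_def gl)
  then show ?thesis by (rule orthogonal_sumI) (auto simp: gl)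
next
  case False
  obtain B :: "'v set" and n where B: "finite B" "card B = 7" "independent B" "span B = UNIV" and n: "g n n < 0"
  proof -
    obtain P N where "finite P" "finite N" "P \<inter> N = {}" "card P = 6" "card N = 1"
      "independent (P \<union> N)" "span (P \<union> N) = UNIV" "\<forall>x\<in>N. g x x < 0"
      using sig unfolding has_signature_def by metis
    moreover then obtain n where "N = {n}" using card_1_singletonE by blast
    ultimately show thesis using that[of "P \<union> N" n] card_Un_disjoint[of P N] by auto
  qed
  have "card (UNIV :: 7 set) = card B" using B by simp
  then obtain basis :: "7 \<Rightarrow> 'v" where "bij_betw basis UNIV B"
    using finite_same_card_bij[of "UNIV :: 7 set" B] B(1) by auto
  then have basis: "inj basis" "range basis = B" by (auto simp: bij_betw_def)
  obtain x u v where xuv: "F x u v \<noteq> 0" using False by (metis ext zero_fun_apply)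
  then have xu: "br x u \<noteq> 0" using g_br[of x u v] by (auto simp: gl)
  \<comment> \<open>If the timelike \<open>n\<close> is central, adding a large multiple of it makes \<open>x\<close> timelike without changing
    the action of \<open>x\<close>.\<close>
  obtain s where s: "g s s < 0" "br s u \<noteq> 0"
  proof (cases "br n u = 0")
    case False
    then show thesis using that n by blast
  next
    case True
    \<comment> \<open>Removing the component along \<open>n\<close> eliminates cross terms, and
      since \<open>br n u = 0\<close> it does not affect the bracket with \<open>u\<close>.\<close>
    define y where "y = x - (g x n / g n n) *\<^sub>R n"
    have yn: "g y n = 0" "g n y = 0" using n sym[of n x] by (simp_all add: y_def gl)
    \<comment> \<open>Chosen so that \<open>c * - g n n\<close> exceeds
      \<open>\<bar>g y y\<bar>\<close>; as \<open>c \<ge> 1\<close>, so does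
      \<open>c\<^sup>2 * - g n n\<close>.\<close>
    define c where "c = \<bar>g y y\<bar> / - g n n + 1"
    have c1: "c \<ge> 1" using n by (simp add: c_def divide_nonneg_neg)
    have "c\<^sup>2 * - g n n \<ge> c * - g n n"
      using c1 n by (intro mult_right_mono) (auto simp: power2_eq_square)
    also have "c * - g n n = \<bar>g y y\<bar> - g n n" using n by (simp add: c_def field_simps)
    finally have "g (y + c *\<^sub>R n) (y + c *\<^sub>R n) < 0"
      using n by (simp add: gl yn power2_eq_square)
    moreover have "br (y + c *\<^sub>R n) u \<noteq> 0" using xu True by (simp add: y_def br_lin)
    ultimately show thesis using that by blast
  qed
  define t where "t = (1 / sqrt (- g s s)) *\<^sub>R s"
  have tt: "g t t = -1" using s(1) by (simp add: t_def gl field_simps)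
  have tu: "br t u \<noteq> 0" using s by (simp add: t_def br_lin)
  interpret timelike_metric_lie g F br t basis
  proof
    show "g t t = - 1" by (rule tt)
    show "g x x > 0" if "g t x = 0" "x \<noteq> 0" for x
      using spacelike_if_orthogonal_timelike[OF bil sym sig _ that] tt by simp
  qed (use basis B in auto)
  show ?thesis by (rule orthogonal_sum_if_noncentral[OF tu])
qed

section \<open>The bracket condition and the converse\<close>

text \<open>\<open>skew_action\<close> is free of the choice of a decomposition and turns the
  condition of the theorem into \<open>jacobi\<close>.\<close>

lemma bracket_contract:
  fixes g :: "'v::real_vector \<Rightarrow> 'v \<Rightarrow> real"
  assumes "lorentzian g" "is_form3 F"
  shows "bracket g (contract X F) F = skew_action g (F X) F"
proof -
  have "is_form2 (F X)" using assms(2) by (auto simp: is_form2_def is_form3_def bilinear_def)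
  then obtain n :: nat and \<alpha> \<beta> where l: "\<And>i. i < n \<Longrightarrow> linear (\<alpha> i) \<and> linear (\<beta> i)"
    and e: "F X = (\<Sum>i<n. wedge11 (\<alpha> i) (\<beta> i))"
    using two_form_decomposition[OF assms(1)] by metis
  show ?thesis
    unfolding contract_def e
    using skew_action_sum[OF assms, of "{..<n}" "\<lambda>i. wedge11 (\<alpha> i) (\<beta> i)"] l
      bracket_wedge_sum[OF assms, of n \<alpha> \<beta>]
    by (simp add: linear_wedge11 bracket11_skew_action[OF assms])
qed

text \<open>\<open>A\<close> stands for \<open>br x\<close>. Once its components along
  \<open>a1\<close>, \<open>a2\<close>, \<open>a3\<close> are inserted, the claim is a polynomial
  identity in values of \<open>g\<close>.\<close>

lemma vol_jacobi:
  fixes g :: "'v \<Rightarrow> 'v \<Rightarrow> real"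
  assumes sym: "\<And>x y. g x y = g y x"
    and A: "\<And>a y. a \<in> {a1, a2, a3} \<Longrightarrow> g a (A y) = vol g a1 a2 a3 x y a"
  shows "vol g a1 a2 a3 (A y) z w + vol g a1 a2 a3 y (A z) w + vol g a1 a2 a3 y z (A w) = 0"
proof -
  have A': "g a1 (A y) = vol g a1 a2 a3 x y a1" "g a2 (A y) = vol g a1 a2 a3 x y a2"
    "g a3 (A y) = vol g a1 a2 a3 x y a3" for y using A by auto
  show ?thesis
    unfolding wedge12_def wedge11_def A' unfolding sym[of a2 a1] sym[of a3 a1] sym[of a3 a2]
    by algebra
qed

text \<open>By orthogonality the vectors of each summand see only that summand in
  \<open>A y\<close>, so the two parts are separate instances of \<open>vol_jacobi\<close>.\<close>

lemma jacobi_if_orthogonal_sum: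
  fixes g :: "'v::real_vector \<Rightarrow> 'v \<Rightarrow> real"
  assumes bil: "bilinear g" and sym: "\<And>x y. g x y = g y x" and os: "orthogonal_sum g F"
    and A: "\<And>y z. g (A y) z = F x y z"
  shows "F (A y) z w + F y (A z) w + F y z (A w) = 0"
proof -
  obtain a1 a2 a3 b1 b2 b3 where o: "\<forall>a\<in>{a1,a2,a3}. \<forall>b\<in>{b1,b2,b3}. g a b = 0"
    and F: "F = vol g a1 a2 a3 + vol g b1 b2 b3" using os unfolding orthogonal_sum_def by blast
  have "g a (A y) = vol g a1 a2 a3 x y a" if "a \<in> {a1,a2,a3}" for a y
  proof -
    have "g b1 a = 0" "g b2 a = 0" "g b3 a = 0" using o that sym[of _ a] by auto
    then show ?thesis using A[of y a] sym[of a "A y"] by (simp add: F wedge12_def wedge11_def)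
  qed
  note a = vol_jacobi[OF sym this]
  have "g b (A y) = vol g b1 b2 b3 x y b" if "b \<in> {b1,b2,b3}" for b y
  proof -
    have "g a1 b = 0" "g a2 b = 0" "g a3 b = 0" using o that by auto
    then show ?thesis using A[of y b] sym[of b "A y"] by (simp add: F wedge12_def wedge11_def)
  qed
  note b = vol_jacobi[OF sym this]
  show ?thesis using a[of y z w] b[of y z w] by (simp add: F)
qed

text \<open>\<open>sharp\<close> exchanges one-forms and vectors, and bilinearity passes
  orthogonality from generators to spans.\<close>

lemma orthogonal_sum_iff:
  fixes g :: "'v::real_vector \<Rightarrow> 'v \<Rightarrow> real"
  assumes lor: "lorentzian g"
  shows "orthogonal_sum g F \<longleftrightarrow>
    (\<exists>F1 F2. simple_form3 F1 \<and> simple_form3 F2 \<and> orthogonal_forms3 g F1 F2 \<and> F = F1 + F2)"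
proof
  have bil: "bilinear g" using lor by (auto simp: lorentzian_def symmetric_bilinear_def)
  have lg: "linear (g y)" "linear (\<lambda>x. g x y)" for y using bil by (auto simp: bilinear_def)
  have z: "g 0 x = 0" "g x 0 = 0" for x using lg linear_0 by blast+
  have vol0: "vol g 0 0 0 = 0" by (intro ext) (simp add: wedge12_def wedge11_def z)
  have sharp: "g (sharp g \<alpha>) = \<alpha>" if "linear \<alpha>" for \<alpha> using lorentzian_sharp[OF lor that] by (rule ext)
  {
    assume "orthogonal_sum g F"
    then obtain a1 a2 a3 b1 b2 b3 where o: "\<forall>a\<in>{a1,a2,a3}. \<forall>b\<in>{b1,b2,b3}. g a b = 0"
      and F: "F = vol g a1 a2 a3 + vol g b1 b2 b3" unfolding orthogonal_sum_def by blast
    have simple: "simple_form3 (vol g a b c)" for a b c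
      unfolding simple_form3_def using lg(1) by blast
    have sg: "sharp g (g a) = a" for a
      by (rule lorentzian_cancel[OF lor]) (simp add: lorentzian_sharp[OF lor lg(1)])
    have plane: "plane_of g (vol g a b c) (span {a, b, c})" if "vol g a b c \<noteq> 0" for a b c
      unfolding plane_of_def
    proof (intro conjI)
      have "span {a, b, c} = span {sharp g (g a), sharp g (g b), sharp g (g c)}" by (simp add: sg)
      then show "\<exists>\<alpha> \<beta> \<gamma>. linear \<alpha> \<and> linear \<beta> \<and> linear \<gamma> \<and> vol g a b c = wedge12 \<alpha> (wedge11 \<beta> \<gamma>) \<and>
          span {a, b, c} = span {sharp g \<alpha>, sharp g \<beta>, sharp g \<gamma>}"
        using lg(1) by blast
    qed (fact that)
    have "subspace {x. \<forall>b\<in>{b1,b2,b3}. g x b = 0}"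
      by (auto simp: subspace_def linear_add[OF lg(2)] linear_scale[OF lg(2)] z)
    then have "span {a1,a2,a3} \<subseteq> {x. \<forall>b\<in>{b1,b2,b3}. g x b = 0}"
      by (intro span_minimal) (use o in auto)
    moreover have "subspace {y. \<forall>x\<in>span {a1,a2,a3}. g x y = 0}"
      by (auto simp: subspace_def linear_add[OF lg(1)] linear_scale[OF lg(1)] z)
    ultimately have "span {b1,b2,b3} \<subseteq> {y. \<forall>x\<in>span {a1,a2,a3}. g x y = 0}"
      by (intro span_minimal) auto
    then have "orthogonal_forms3 g (vol g a1 a2 a3) (vol g b1 b2 b3)"
      unfolding orthogonal_forms3_def using plane by blast
    then show "\<exists>F1 F2. simple_form3 F1 \<and> simple_form3 F2 \<and> orthogonal_forms3 g F1 F2 \<and> F = F1 + F2"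
      using simple F by blast
  }
  {
    assume "\<exists>F1 F2. simple_form3 F1 \<and> simple_form3 F2 \<and> orthogonal_forms3 g F1 F2 \<and> F = F1 + F2"
    then obtain F1 F2 where F12: "simple_form3 F1" "simple_form3 F2" "orthogonal_forms3 g F1 F2" "F = F1 + F2"
      by blast
    have vol: "\<exists>a b c. G = vol g a b c" if G: "simple_form3 G" for G
    proof -
      obtain \<alpha> \<beta> \<gamma> where "linear \<alpha>" "linear \<beta>" "linear \<gamma>" "G = wedge12 \<alpha> (wedge11 \<beta> \<gamma>)"
        using G unfolding simple_form3_def by blast
      then have "G = vol g (sharp g \<alpha>) (sharp g \<beta>) (sharp g \<gamma>)" by (simp add: sharp)
      then show ?thesis by blast
    qed
    consider "F1 = 0" | "F2 = 0" | S1 S2 where "plane_of g F1 S1" "plane_of g F2 S2"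
      "\<forall>X1\<in>S1. \<forall>X2\<in>S2. g X1 X2 = 0" using F12(3) unfolding orthogonal_forms3_def by blast
    then show "orthogonal_sum g F"
    proof cases
      case 1
      obtain a b c where "F2 = vol g a b c" using vol[OF F12(2)] by blast
      then have "F = vol g 0 0 0 + vol g a b c" unfolding F12(4) 1 vol0 by simp
      then show ?thesis by (rule orthogonal_sumI) (auto simp: z)
    next
      case 2
      obtain a b c where "F1 = vol g a b c" using vol[OF F12(1)] by blast
      then have "F = vol g a b c + vol g 0 0 0" unfolding F12(4) 2 vol0 by simp
      then show ?thesis by (rule orthogonal_sumI) (auto simp: z)
    next
      case 3
      have plane: "\<exists>a b c. G = vol g a b c \<and> {a, b, c} \<subseteq> S" if GS: "plane_of g G S" for G S
      proof -
        obtain \<alpha> \<beta> \<gamma> where *: "linear \<alpha>" "linear \<beta>" "linear \<gamma>" "G = wedge12 \<alpha> (wedge11 \<beta> \<gamma>)"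
          "S = span {sharp g \<alpha>, sharp g \<beta>, sharp g \<gamma>}"
          using GS by (auto simp: plane_of_def)
        then have "G = vol g (sharp g \<alpha>) (sharp g \<beta>) (sharp g \<gamma>)" by (simp add: sharp)
        moreover have "{sharp g \<alpha>, sharp g \<beta>, sharp g \<gamma>} \<subseteq> S" unfolding *(5) by (rule span_superset)
        ultimately show ?thesis by (intro exI conjI)
      qed
      obtain a1 a2 a3 where a: "F1 = vol g a1 a2 a3" "{a1, a2, a3} \<subseteq> S1"
        using plane[OF 3(1)] by (elim exE conjE)
      obtain b1 b2 b3 where b: "F2 = vol g b1 b2 b3" "{b1, b2, b3} \<subseteq> S2"
        using plane[OF 3(2)] by (elim exE conjE)
      show ?thesis
        by (rule orthogonal_sumI[OF F12(4)[unfolded a(1) b(1)]])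
          (use 3(3) subsetD[OF a(2)] subsetD[OF b(2)] in simp)
    qed
  }
qed

lemma has_signature_uminus:
  fixes g :: "'v::real_vector \<Rightarrow> 'v \<Rightarrow> real"
  assumes "has_signature g p q"
  shows "has_signature (\<lambda>x y. - g x y) q p"
proof -
  obtain P N where "finite P" "finite N" "P \<inter> N = {}" "card P = p" "card N = q"
      "independent (P \<union> N)" "span (P \<union> N) = UNIV" "pairwise (\<lambda>x y. g x y = 0) (P \<union> N)"
      "\<forall>x\<in>P. g x x > 0" "\<forall>x\<in>N. g x x < 0"
    using assms unfolding has_signature_def by metis
  then show ?thesis unfolding has_signature_def
    by (intro exI[of _ N] exI[of _ P]) (simp add: Un_commute Int_commute)
qed

theorem mainTheorem3:
  fixes g :: "'v::real_vector \<Rightarrow> 'v \<Rightarrow> real" and F :: "'v form3"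
  assumes "dim (UNIV :: 'v set) = 7"
    and "lorentzian g"
    and "is_form3 F"
  shows "(\<forall>X. bracket g (contract X F) F = 0) \<longleftrightarrow>
    (\<exists>F1 F2. simple_form3 F1 \<and> simple_form3 F2 \<and> orthogonal_forms3 g F1 F2 \<and> F = F1 + F2)"
proof -
  have bil: "bilinear g" and sym: "\<And>x y. g x y = g y x"
    using assms(2) by (auto simp: lorentzian_def symmetric_bilinear_def)
  define br where "br x y = sharp g (F x y)" for x y
  have "linear (F x y)" for x y using assms(3) by (auto simp: is_form3_def)
  then have g_br: "g (br x y) z = F x y z" for x y z
    unfolding br_def by (rule lorentzian_sharp[OF assms(2)])
  have nondeg: "x = 0" if "\<And>y. g x y = 0" for x
    using assms(2) that by (auto simp: lorentzian_def nondegenerate_def)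
  have "bracket g (contract X F) F = 0 \<longleftrightarrow>
      (\<forall>Y Z W. F (br X Y) Z W + F Y (br X Z) W + F Y Z (br X W) = 0)" for X
    unfolding bracket_contract[OF assms(2,3)] skew_action_def br_def by (simp add: fun_eq_iff)
  moreover have "orthogonal_sum g F"
    if jac: "\<And>X Y Z W. F (br X Y) Z W + F Y (br X Z) W + F Y Z (br X W) = 0"
  proof -
    consider "has_signature g 6 1" | "has_signature g 1 6"
      using assms(1,2) unfolding lorentzian_def by auto
    then show ?thesis
    proof cases
      case 1
      interpret metric_lie g F br
        by standard (fact bil sym nondeg assms(3) g_br jac)+
      show ?thesis by (rule orthogonal_sum_if_signature[OF 1])
    next
      case 2
      \<comment> \<open>Reversing the signs of \<open>g\<close> and \<open>br\<close> together keeps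
        \<open>F\<close> and the Jacobi identity and exchanges the two signatures.\<close>
      let ?g = "\<lambda>x y. - g x y"
      interpret neg: metric_lie ?g F "\<lambda>x y. - br x y"
      proof
        show "bilinear ?g" using bil unfolding bilinear_def
          by (auto intro: linear_compose_neg)
        show "?g (- br x y) z = F x y z" for x y z using bilinear_lneg[OF bil] g_br by simp
        show "F (- br x y) z w + F y (- br x z) w + F y z (- br x w) = 0" for x y z w
        proof -
          have "linear (\<lambda>X. F X z w)" "linear (\<lambda>Y. F y Y w)" "linear (\<lambda>Z. F y z Z)"
            using assms(3) by (auto simp: is_form3_def)
          from this[THEN linear_neg] show ?thesis using jac[of x y z w] by simp
        qed
      qed (use sym nondeg assms(3) in auto)
      obtain a1 a2 a3 b1 b2 b3 where o: "\<forall>a\<in>{a1,a2,a3}. \<forall>b\<in>{b1,b2,b3}. ?g a b = 0"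
        and F: "F = vol ?g a1 a2 a3 + vol ?g b1 b2 b3"
        using neg.orthogonal_sum_if_signature[OF has_signature_uminus[OF 2]] unfolding orthogonal_sum_def by blast
      \<comment> \<open>The sign of \<open>- g\<close> is absorbed factor by factor into the
        vectors.\<close>
      have "F = vol g (- a1) (- a2) (- a3) + vol g (- b1) (- b2) (- b3)"
        unfolding F by (intro ext) (simp add: wedge12_def wedge11_def bilinear_lneg[OF bil])
      then show ?thesis
        by (rule orthogonal_sumI) (use o in \<open>auto simp: bilinear_lneg[OF bil] bilinear_rneg[OF bil]\<close>)
    qed
  qed
  moreover have "F (br x y) z w + F y (br x z) w + F y z (br x w) = 0" if "orthogonal_sum g F" for x y z w
    using jacobi_if_orthogonal_sum[OF bil sym that, where A = "br x"] g_br by blast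
  ultimately show ?thesis
    unfolding orthogonal_sum_iff[OF assms(2), symmetric] by blast
qed

end
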